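(* Let $F$ be a finite-rank free group, $X$ an $F$-basis, and $R$ a finite subset of $\{g,\ {}^Fg : g\in F\setminus\{1\}\}$. Consider the following procedure with input $(X,R)$. Ask whether there exists some $Y\in\mathcal{P}(X;R)$ such that $\mathbb{W}(Y,R_{|Y,X})$ has a $Y$-cutvertex. If yes, then the subroutine described in the context, applied to such a $Y$ and $S=R_{|Y,X}$, outputs a Whitehead neighbour $Y'$ of $Y$ (in the free group $\langle Y\rangle$) such that $Y'\text{-length}(R_{|Y,X})<Y\text{-length}(R_{|Y,X})$; start anew with $X$ replaced by $X':=(X\setminus Y)\cup Y'$, which is a Whitehead neighbour of $X$ with $X'\text{-length}(R)<X\text{-length}(R)$. If no, output $X$ and stop. This algorithm eventually outputs an $R$-cutvertex-free $F$-basis, and then stops.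
   Context: For $f,g\in F$, ${}^fg:=fgf^{-1}$ and ${}^Fg:=\{{}^fg: f\in F\}$. An $F$-basis is a free-generating set of $F$. An $F$-element is an element of $F$; an $F$-class is a conjugacy class ${}^Fg$. Thus $R$ is a finite set of nontrivial $F$-elements and nontrivial $F$-classes. For an $F$-basis $X$ put $X^{\pm1}:=X\cup X^{-1}$ and $X^{0,\pm1}:=\{1\}\cup X^{\pm1}$. Let $r$ be a nontrivial $F$-element (resp. nontrivial $F$-class). There is a finite sequence $(x_1,\ldots,x_n)$ in $X^{\pm1}$, unique (resp. unique up to cyclic permutation), such that $r$ equals (resp. contains) $x_1\cdots x_n$ and $x_i^{-1}\ne x_{i+1}$ for all $i\in\{0,1,\ldots,n\}$, where $x_0:=x_{n+1}:=1$ (resp. $x_0:=x_n$, $x_{n+1}:=x_1$). Define $X\text{-length}(r):=n$, the set of $X$-turns of $r$ to be $\{(x_i^{-1},x_{i+1}) : 0\le i\le n\}\subseteq X^{0,\pm1}\times X^{0,\pm1}$, and $X\text{-support}(r):=\{x_1,\ldots,x_n\}^{\pm1}\cap X$. Then $X\text{-length}(R):=\sum_{r\in R}X\text{-length}(r)$, and the $X$-turns of $R$ are the $X$-turns of the elements of $R$. $\mathcal{P}(X;R)$ denotes the finest partition of $X$ such that for each $r\in R$ some element of the partition includes $X\text{-support}(r)$. For $Y\in\mathcal{P}(X;R)$, $R_{|Y,X}:=\{r\in R : X\text{-support}(r)\subseteq Y\}$, viewed as a set of $\langle Y\rangle$-elements and $\langle Y\rangle$-classes; here $\mathcal{P}(Y;R_{|Y,X})=\{Y\}$.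 A graph $\Gamma$ is a vertex-set $V$ together with an edge-set $E\subseteq V\times V$; an edge $(v,w)$ meets $v$ and $w$ and meets every subset of $V$ containing $v$ or $w$. A vertex $v_\dag$ is a cutvertex of $\Gamma$ if $V\setminus\{v_\dag\}$ is the union of two disjoint nonempty subsets $V_1,V_2$ such that no edge meets both $V_1$ and $V_2$ (connectivity of $\Gamma$ is not assumed). $\mathbb{W}(X,R)$ is the graph whose edges are the $X$-turns of $R$ and whose vertices are the elements of $X^{0,\pm1}$ met by some $X$-turn of $R$. An $X$-cutvertex of $\mathbb{W}(X,R)$ is a cutvertex lying in $X^{\pm1}$ (i.e. different from $1$). The basis $X$ is $R$-cutvertex-free if, for each $Y\in\mathcal{P}(X;R)$, $\mathbb{W}(Y,R_{|Y,X})$ has no $Y$-cutvertices. An $F$-basis $X'$ is a Whitehead neighbour of $X$ if $X'\subseteq\{1,y^{-1}\}\cdot X\cdot\{1,y\}$ for some $y\in(X\cap X')^{\pm1}$. The subroutine, for a free group with basis $Y$ and a finite set $S$ of nontrivial elements and nontrivial classes of it such that $\mathcal{P}(Y;S)=\{Y\}$ and $\Gamma:=\mathbb{W}(Y,S)$ has a $Y$-cutvertex: choose $y_\dag\in Y^{\pm1}$ and disjoint subsets $Y_-,Y_+$ with union (vertex-set of $\Gamma$)$\,\setminus\{y_\dag\}$ such that $y_\dag^{-1}\in Y_-$, no $\Gamma$-edge meets both $Y_-$ and $Y_+$, and some $\Gamma$-edge meets both $Y_+$ and $y_\dag$. Let $\ell:=-1$ if $1\in Y_+$ and $\ell:=0$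 otherwise, and let $\chi:Y^{0,\pm1}\to\{\ell,\ell+1\}$ take the value $0$ at $1$, $\ell$ on $Y_-\cup\{y_\dag\}$ and $\ell+1$ on $Y_+$. Output $Y':=\{y_\dag^{-\chi(x)}\,x\,y_\dag^{\chi(x^{-1})} : x\in Y\}$. *)

theory Defs
  imports "HOL-Algebra.Generated_Groups" "HOL-Library.Disjoint_Sets"
begin

definition list_prod :: "('a, 'b) monoid_scheme \<Rightarrow> 'a list \<Rightarrow> 'a" where
  "list_prod G xs = foldr (\<lambda>x y. x \<otimes>\<^bsub>G\<^esub> y) xs \<one>\<^bsub>G\<^esub>"

text \<open>The letter \<open>(x, True)\<close> stands for \<open>x\<close> and \<open>(x, False)\<close> for its formal inverse.\<close>

definition letter_val :: "('a, 'b) monoid_scheme \<Rightarrow> 'a \<times> bool \<Rightarrow> 'a" where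
  "letter_val G a = (if snd a then fst a else inv\<^bsub>G\<^esub> (fst a))"

definition reduced_word :: "('a \<times> bool) list \<Rightarrow> bool" where
  "reduced_word w \<longleftrightarrow>
     (\<forall>i. Suc i < length w \<longrightarrow> \<not> (fst (w ! i) = fst (w ! Suc i) \<and> snd (w ! i) \<noteq> snd (w ! Suc i)))"

text \<open>Free generation: \<open>X\<close> generates, and no nonempty formally reduced word is trivial.
  Formal words over \<open>X \<times> bool\<close> are needed here: if letters were compared as group elements,
  generators of order two would not be excluded.\<close>

definition basis :: "('a, 'b) monoid_scheme \<Rightarrow> 'a set \<Rightarrow> bool" where
  "basis G X \<longleftrightarrow> X \<subseteq> carrier G \<and> generate G X = carrier G \<and>
     (\<forall>w. fst ` set w \<subseteq> X \<and> reduced_word w \<and> w \<noteq> [] \<longrightarrow>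
        list_prod G (map (letter_val G) w) \<noteq> \<one>\<^bsub>G\<^esub>)"

definition finite_rank_free_group :: "('a, 'b) monoid_scheme \<Rightarrow> bool" where
  "finite_rank_free_group G \<longleftrightarrow> group G \<and> (\<exists>B. finite B \<and> basis G B)"

definition conj_class :: "('a, 'b) monoid_scheme \<Rightarrow> 'a \<Rightarrow> 'a set" where
  "conj_class G g = {f \<otimes>\<^bsub>G\<^esub> g \<otimes>\<^bsub>G\<^esub> inv\<^bsub>G\<^esub> f | f. f \<in> carrier G}"

datatype 'a item = Elt 'a | Cls "'a set"

definition nontrivial_items :: "('a, 'b) monoid_scheme \<Rightarrow> 'a item set" where
  "nontrivial_items G =
     {Elt g | g. g \<in> carrier G - {\<one>\<^bsub>G\<^esub>}} \<union> {Cls (conj_class G g) | g. g \<in> carrier G - {\<one>\<^bsub>G\<^esub>}}"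

definition pm :: "('a, 'b) monoid_scheme \<Rightarrow> 'a set \<Rightarrow> 'a set" where
  "pm G X = X \<union> (\<lambda>x. inv\<^bsub>G\<^esub> x) ` X"

definition zpm :: "('a, 'b) monoid_scheme \<Rightarrow> 'a set \<Rightarrow> 'a set" where
  "zpm G X = insert \<one>\<^bsub>G\<^esub> (pm G X)"

text \<open>\<open>bordered G r [x\<^sub>1,\<dots>,x\<^sub>n]\<close> is \<open>[x\<^sub>0,x\<^sub>1,\<dots>,x\<^sub>n,x\<^sub>n\<^sub>+\<^sub>1]\<close>, with \<open>x\<^sub>0 = x\<^sub>n\<^sub>+\<^sub>1 = 1\<close> for an
  element and \<open>x\<^sub>0 = x\<^sub>n\<close>, \<open>x\<^sub>n\<^sub>+\<^sub>1 = x\<^sub>1\<close> for a class.\<close>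

fun bordered :: "('a, 'b) monoid_scheme \<Rightarrow> 'a item \<Rightarrow> 'a list \<Rightarrow> 'a list" where
  "bordered G (Elt g) xs = \<one>\<^bsub>G\<^esub> # xs @ [\<one>\<^bsub>G\<^esub>]"
| "bordered G (Cls C) xs = last xs # xs @ [hd xs]"

fun represents :: "('a, 'b) monoid_scheme \<Rightarrow> 'a list \<Rightarrow> 'a item \<Rightarrow> bool" where
  "represents G xs (Elt g) \<longleftrightarrow> list_prod G xs = g"
| "represents G xs (Cls C) \<longleftrightarrow> list_prod G xs \<in> C"

definition is_spelling :: "('a, 'b) monoid_scheme \<Rightarrow> 'a set \<Rightarrow> 'a item \<Rightarrow> 'a list \<Rightarrow> bool" where
  "is_spelling G X r xs \<longleftrightarrow> set xs \<subseteq> pm G X \<and> represents G xs r \<and>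
     (\<forall>i \<le> length xs. inv\<^bsub>G\<^esub> (bordered G r xs ! i) \<noteq> bordered G r xs ! Suc i)"

text \<open>For a class the spelling is unique only up to cyclic permutation; the length, the set of
  turns and the support do not depend on the choice.\<close>

definition spelling :: "('a, 'b) monoid_scheme \<Rightarrow> 'a set \<Rightarrow> 'a item \<Rightarrow> 'a list" where
  "spelling G X r = (SOME xs. is_spelling G X r xs)"

definition item_length :: "('a, 'b) monoid_scheme \<Rightarrow> 'a set \<Rightarrow> 'a item \<Rightarrow> nat" where
  "item_length G X r = length (spelling G X r)"

definition turns :: "('a, 'b) monoid_scheme \<Rightarrow> 'a set \<Rightarrow> 'a item \<Rightarrow> ('a \<times> 'a) set" where
  "turns G X r =
     (let xs = spelling G X r; bs = bordered G r xs
      in {(inv\<^bsub>G\<^esub> (bs ! i), bs ! Suc i) | i. i \<le> length xs})"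

definition support :: "('a, 'b) monoid_scheme \<Rightarrow> 'a set \<Rightarrow> 'a item \<Rightarrow> 'a set" where
  "support G X r = pm G (set (spelling G X r)) \<inter> X"

definition total_length :: "('a, 'b) monoid_scheme \<Rightarrow> 'a set \<Rightarrow> 'a item set \<Rightarrow> nat" where
  "total_length G X R = (\<Sum>r\<in>R. item_length G X r)"

definition admissible_partition ::
  "('a, 'b) monoid_scheme \<Rightarrow> 'a set \<Rightarrow> 'a item set \<Rightarrow> 'a set set \<Rightarrow> bool" where
  "admissible_partition G X R P \<longleftrightarrow>
     partition_on X P \<and> (\<forall>r\<in>R. \<exists>Y\<in>P. support G X r \<subseteq> Y)"

definition finest_partition :: "('a, 'b) monoid_scheme \<Rightarrow> 'a set \<Rightarrow> 'a item set \<Rightarrow> 'a set set" where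
  "finest_partition G X R =
     (THE P. admissible_partition G X R P \<and>
        (\<forall>Q. admissible_partition G X R Q \<longrightarrow> refines X P Q))"

text \<open>An element of the free factor \<open>H\<close> is kept; a class of \<open>G\<close> meeting \<open>H\<close> becomes the class of
  \<open>H\<close> that it contains, which is its intersection with \<open>H\<close>.\<close>

fun item_in :: "'a set \<Rightarrow> 'a item \<Rightarrow> 'a item" where
  "item_in H (Elt g) = Elt g"
| "item_in H (Cls C) = Cls (C \<inter> H)"

definition restrict_items ::
  "('a, 'b) monoid_scheme \<Rightarrow> 'a set \<Rightarrow> 'a item set \<Rightarrow> 'a set \<Rightarrow> 'a item set" where
  "restrict_items G X R Y =
     item_in (carrier (subgroup_generated G Y)) ` {r \<in> R. support G X r \<subseteq> Y}"

type_synonym 'a graph = "'a set \<times> ('a \<times> 'a) set"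

definition meets :: "'a \<times> 'a \<Rightarrow> 'a set \<Rightarrow> bool" where
  "meets e A \<longleftrightarrow> fst e \<in> A \<or> snd e \<in> A"

definition cutvertex :: "'a graph \<Rightarrow> 'a \<Rightarrow> bool" where
  "cutvertex \<Gamma> v \<longleftrightarrow> v \<in> fst \<Gamma> \<and>
     (\<exists>V1 V2. fst \<Gamma> - {v} = V1 \<union> V2 \<and> V1 \<inter> V2 = {} \<and> V1 \<noteq> {} \<and> V2 \<noteq> {} \<and>
        \<not> (\<exists>e \<in> snd \<Gamma>. meets e V1 \<and> meets e V2))"

definition whitehead_graph :: "('a, 'b) monoid_scheme \<Rightarrow> 'a set \<Rightarrow> 'a item set \<Rightarrow> 'a graph" where
  "whitehead_graph G X R =
     (let E = (\<Union>r\<in>R. turns G X r) in ({v \<in> zpm G X. \<exists>e\<in>E. meets e {v}}, E))"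

definition has_basis_cutvertex :: "('a, 'b) monoid_scheme \<Rightarrow> 'a set \<Rightarrow> 'a item set \<Rightarrow> bool" where
  "has_basis_cutvertex G X R \<longleftrightarrow> (\<exists>v \<in> pm G X. cutvertex (whitehead_graph G X R) v)"

definition block_has_cutvertex ::
  "('a, 'b) monoid_scheme \<Rightarrow> 'a set \<Rightarrow> 'a item set \<Rightarrow> 'a set \<Rightarrow> bool" where
  "block_has_cutvertex G X R Y \<longleftrightarrow>
     has_basis_cutvertex (subgroup_generated G Y) Y (restrict_items G X R Y)"

definition cutvertex_free :: "('a, 'b) monoid_scheme \<Rightarrow> 'a item set \<Rightarrow> 'a set \<Rightarrow> bool" where
  "cutvertex_free G R X \<longleftrightarrow> (\<forall>Y \<in> finest_partition G X R. \<not> block_has_cutvertex G X R Y)"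

definition whitehead_neighbour :: "('a, 'b) monoid_scheme \<Rightarrow> 'a set \<Rightarrow> 'a set \<Rightarrow> bool" where
  "whitehead_neighbour G X X' \<longleftrightarrow> basis G X \<and> basis G X' \<and>
     (\<exists>y \<in> pm G (X \<inter> X'). X' \<subseteq> ({\<one>\<^bsub>G\<^esub>, inv\<^bsub>G\<^esub> y} <#>\<^bsub>G\<^esub> X) <#>\<^bsub>G\<^esub> {\<one>\<^bsub>G\<^esub>, y})"

definition subroutine_input :: "('a, 'b) monoid_scheme \<Rightarrow> 'a set \<Rightarrow> 'a item set \<Rightarrow> bool" where
  "subroutine_input G Y S \<longleftrightarrow> group G \<and> basis G Y \<and> finite S \<and> S \<subseteq> nontrivial_items G \<and>
     finest_partition G Y S = {Y} \<and> has_basis_cutvertex G Y S"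

text \<open>The subroutine involves choices, so its outputs are described by a relation.\<close>

definition subroutine_output ::
  "('a, 'b) monoid_scheme \<Rightarrow> 'a set \<Rightarrow> 'a item set \<Rightarrow> 'a set \<Rightarrow> bool" where
  "subroutine_output G Y S Y' \<longleftrightarrow>
     (let \<Gamma> = whitehead_graph G Y S in
      \<exists>y Ym Yp. \<exists>\<chi> :: 'a \<Rightarrow> int.
        y \<in> pm G Y \<and> Ym \<inter> Yp = {} \<and> Ym \<union> Yp = fst \<Gamma> - {y} \<and> inv\<^bsub>G\<^esub> y \<in> Ym \<and>
        \<not> (\<exists>e \<in> snd \<Gamma>. meets e Ym \<and> meets e Yp) \<and>
        (\<exists>e \<in> snd \<Gamma>. meets e Yp \<and> meets e {y}) \<and>
        (let l = (if \<one>\<^bsub>G\<^esub> \<in> Yp then -1 else 0) in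
          \<chi> ` zpm G Y \<subseteq> {l, l + 1} \<and> \<chi> \<one>\<^bsub>G\<^esub> = 0 \<and>
          (\<forall>x \<in> Ym \<union> {y}. \<chi> x = l) \<and> (\<forall>x \<in> Yp. \<chi> x = l + 1)) \<and>
        Y' = {y [^]\<^bsub>G\<^esub> (- \<chi> x) \<otimes>\<^bsub>G\<^esub> x \<otimes>\<^bsub>G\<^esub> y [^]\<^bsub>G\<^esub> \<chi> (inv\<^bsub>G\<^esub> x) | x. x \<in> Y})"

text \<open>One pass through the loop; both the block and the subroutine's output are free choices.\<close>

definition algorithm_step ::
  "('a, 'b) monoid_scheme \<Rightarrow> 'a item set \<Rightarrow> 'a set \<Rightarrow> 'a set \<Rightarrow> bool" where
  "algorithm_step G R X X' \<longleftrightarrow>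
     (\<exists>Y \<in> finest_partition G X R. block_has_cutvertex G X R Y \<and>
        (\<exists>Y'. subroutine_output (subgroup_generated G Y) Y (restrict_items G X R Y) Y' \<and>
              X' = (X - Y) \<union> Y'))"

definition algorithm_reaches ::
  "('a, 'b) monoid_scheme \<Rightarrow> 'a item set \<Rightarrow> 'a set \<Rightarrow> 'a set \<Rightarrow> bool" where
  "algorithm_reaches G R = (algorithm_step G R)\<^sup>*\<^sup>*"

definition algorithm_outputs ::
  "('a, 'b) monoid_scheme \<Rightarrow> 'a item set \<Rightarrow> 'a set \<Rightarrow> 'a set \<Rightarrow> bool" where
  "algorithm_outputs G R X Z \<longleftrightarrow> algorithm_reaches G R X Z \<and>
     \<not> (\<exists>Y \<in> finest_partition G Z R. block_has_cutvertex G Z R Y)"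

end

theory Submission
  imports Defs
begin

text \<open>
  Two facts carry the theorem: the subroutine applies whenever a block of the finest partition has
  a cutvertex, and its output is a basis over which the items are shorter in total. The total
  length is a natural number, so the procedure stops, and it stops only when no block has a
  cutvertex.

  Lengths are controlled by the classical facts on free groups. Reduced words are unique, and
  cyclically reduced words that are conjugate are rotations of each other
  (\<open>conj_cyc_reduced_rotate\<close>). So a spelling of an item is a shortest word representing it, and
  it suffices to exhibit a short word over the new basis.

  The output of the subroutine is the image of the basis under
  \<open>x \<mapsto> y\<^bsup>-\<chi>(x)\<^esup> x y\<^bsup>\<chi>(x\<^sup>-\<^sup>1)\<^esup>\<close>, and it is a basis because the
  inverse transformation extends to an endomorphism (\<open>basis_whitehead_map\<close>). To rewrite a word,
  a power of \<open>y\<close> and its inverse are inserted at every turn, with the larger \<open>\<chi>\<close>-value of the turn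
  as exponent. All turns are edges of the Whitehead graph, so the two values agree except where
  the turn joins \<open>y\<close> to the upper side \<open>Y\<^sub>+\<close>, and there a letter \<open>y\<^sup>\<plusminus>\<^sup>1\<close> of the word is cancelled
  (\<open>whitehead_map_word\<close>). An edge of this kind is required to exist, hence the decrease
  (\<open>subroutine_output_decreases\<close>).

  The given cutvertex itself need not admit such an edge when the graph is disconnected. A
  union of components can then be split off at another letter, or else it separates the supports of the
  items and contradicts the minimality of the partition (\<open>subroutine_applicable\<close>).

  The subroutine works inside the free factor \<open>H\<close> generated by a block \<open>Y\<close>. A class of the whole
  group spelled in \<open>Y\<close> meets \<open>H\<close> in exactly one class of \<open>H\<close> (\<open>item_in_free_factor\<close>), which
  makes lengths and supports over \<open>Y\<close> agree with those over \<open>X\<close> and transfers the decrease from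
  the block to the whole basis (\<open>block_subroutine_decreases\<close>).
\<close>

section \<open>Words in the letters of a basis\<close>

text \<open>Words are lists of group elements rather than of formal letters. For a basis nothing is
  lost: no generator is the inverse of a generator, so a formal letter can be recovered from its
  value.\<close>

definition inv_word :: "('a, 'b) monoid_scheme \<Rightarrow> 'a list \<Rightarrow> 'a list" where
  "inv_word G w = map (\<lambda>a. inv\<^bsub>G\<^esub> a) (rev w)"

definition free_reduced :: "('a, 'b) monoid_scheme \<Rightarrow> 'a list \<Rightarrow> bool" where
  "free_reduced G w \<longleftrightarrow> successively (\<lambda>a b. inv\<^bsub>G\<^esub> a \<noteq> b) w"

fun free_reduce :: "('a, 'b) monoid_scheme \<Rightarrow> 'a list \<Rightarrow> 'a list" where
  "free_reduce G [] = []"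
| "free_reduce G (a # w) =
     (case free_reduce G w of [] \<Rightarrow> [a] | b # v \<Rightarrow> if inv\<^bsub>G\<^esub> a = b then v else a # b # v)"

lemma list_prod_simps [simp]:
  "list_prod G [] = \<one>\<^bsub>G\<^esub>" "list_prod G (a # w) = a \<otimes>\<^bsub>G\<^esub> list_prod G w"
  by (simp_all add: list_prod_def)

lemma length_free_reduce: "length (free_reduce G w) \<le> length w"
  by (induction w) (auto split: list.splits)

lemma set_free_reduce: "set (free_reduce G w) \<subseteq> set w"
  by (induction w) (auto split: list.splits)

lemma free_reduced_free_reduce: "free_reduced G (free_reduce G w)"
  unfolding free_reduced_def
  by (induction w) (auto split: list.splits simp: successively_Cons)

context group
begin

lemma list_prod_closed [simp]: "set w \<subseteq> carrier G \<Longrightarrow> list_prod G w \<in> carrier G"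
  by (induction w) auto

lemma list_prod_append:
  "set v \<subseteq> carrier G \<Longrightarrow> set w \<subseteq> carrier G \<Longrightarrow> list_prod G (v @ w) = list_prod G v \<otimes> list_prod G w"
  by (induction v) (auto simp: m_assoc)

lemma list_prod_inv_word:
  "set w \<subseteq> carrier G \<Longrightarrow> list_prod G (inv_word G w) = inv (list_prod G w)"
proof (induction w)
  case (Cons a w)
  moreover from this have "set (inv_word G w) \<subseteq> carrier G" by (auto simp: inv_word_def)
  ultimately show ?case
    using list_prod_append[of "inv_word G w" "[inv a]"] by (simp add: inv_word_def inv_mult_group)
qed (simp add: inv_word_def)

lemma list_prod_drop_ones:
  "set w \<subseteq> carrier G \<Longrightarrow> list_prod G (filter (\<lambda>a. a \<noteq> \<one>) w) = list_prod G w"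
  by (induction w) auto

lemma list_prod_rotate:
  assumes "set w \<subseteq> carrier G"
  shows "\<exists>m. list_prod G (rotate n w) =
    inv (list_prod G (take m w)) \<otimes> list_prod G w \<otimes> list_prod G (take m w)"
proof -
  define m where "m = n mod length w"
  have t: "set (take m w) \<subseteq> carrier G" "set (drop m w) \<subseteq> carrier G"
    using assms by (meson order_trans set_take_subset set_drop_subset)+
  have "list_prod G w = list_prod G (take m w) \<otimes> list_prod G (drop m w)"
    using list_prod_append[OF t] by simp
  then have "list_prod G (rotate n w) =
    inv (list_prod G (take m w)) \<otimes> list_prod G w \<otimes> list_prod G (take m w)"
    using t by (simp add: rotate_drop_take m_def[symmetric] list_prod_append m_assoc[symmetric])
  then show ?thesis ..
qed

text \<open>Free reduction only cancels pairs \<open>a, a\<^sup>-\<^sup>1\<close>, so every assignment of the letters that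
  respects inverses cannot tell a word from its reduction. With the identity as the assignment
  this says that reduction keeps the value; the general case gives the universal property of a
  basis.\<close>

lemma list_prod_map_free_reduce:
  assumes "set w \<subseteq> L" "\<And>a. a \<in> L \<Longrightarrow> k a \<in> carrier G"
    and "\<And>a. a \<in> L \<Longrightarrow> inv\<^bsub>H\<^esub> a \<in> L \<Longrightarrow> k (inv\<^bsub>H\<^esub> a) = inv (k a)"
  shows "list_prod G (map k (free_reduce H w)) = list_prod G (map k w)"
  using assms(1)
proof (induction w)
  case (Cons a w)
  then have IH: "list_prod G (map k (free_reduce H w)) = list_prod G (map k w)" by simp
  show ?case
  proof (cases "free_reduce H w")
    case Nil
    then show ?thesis using IH by simp
  next
    case (Cons b v)
    have bv: "set (b # v) \<subseteq> L"
      using set_free_reduce[of H w] Cons.prems unfolding Cons by auto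
    then have "set (map k v) \<subseteq> carrier G" using assms(2) by auto
    then have v: "list_prod G (map k v) \<in> carrier G" by (rule list_prod_closed)
    show ?thesis
    proof (cases "inv\<^bsub>H\<^esub> a = b")
      case True
      then have "k b = inv (k a)" using assms(3)[of a] bv Cons.prems by auto
      moreover have "k a \<in> carrier G" using Cons.prems assms(2) by auto
      ultimately show ?thesis using IH[symmetric] Cons True v by (simp add: m_assoc[symmetric])
    next
      case False
      then show ?thesis using IH Cons by simp
    qed
  qed
qed simp

lemma list_prod_free_reduce:
  assumes "set w \<subseteq> carrier G"
  shows "list_prod G (free_reduce G w) = list_prod G w"
  using list_prod_map_free_reduce[OF assms, of "\<lambda>a. a" G] by simp

lemma pm_carrier: "X \<subseteq> carrier G \<Longrightarrow> pm G X \<subseteq> carrier G"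
  by (auto simp: pm_def)

lemma inv_pm: "X \<subseteq> carrier G \<Longrightarrow> a \<in> pm G X \<Longrightarrow> inv a \<in> pm G X"
  by (auto simp: pm_def)

lemma pm_mono: "X \<subseteq> Z \<Longrightarrow> pm G X \<subseteq> pm G Z"
  by (auto simp: pm_def)

lemma set_inv_word:
  "X \<subseteq> carrier G \<Longrightarrow> set w \<subseteq> pm G X \<Longrightarrow> set (inv_word G w) \<subseteq> pm G X"
  using inv_pm by (auto simp: inv_word_def)

lemma generate_conv_words:
  assumes "X \<subseteq> carrier G"
  shows "g \<in> generate G X \<longleftrightarrow> (\<exists>w. set w \<subseteq> pm G X \<and> list_prod G w = g)"
proof
  assume "g \<in> generate G X"
  then show "\<exists>w. set w \<subseteq> pm G X \<and> list_prod G w = g"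
  proof (induction rule: generate.induct)
    case one
    show ?case by (intro exI[of _ "[]"]) simp
  next
    case (incl h)
    then show ?case using assms by (intro exI[of _ "[h]"]) (auto simp: pm_def)
  next
    case (inv h)
    then show ?case using assms by (intro exI[of _ "[inv h]"]) (auto simp: pm_def)
  next
    case (eng h1 h2)
    then obtain v w where "set v \<subseteq> pm G X" "list_prod G v = h1" "set w \<subseteq> pm G X" "list_prod G w = h2"
      by blast
    then show ?case
      using pm_carrier[OF assms] by (intro exI[of _ "v @ w"]) (auto simp: list_prod_append)
  qed
next
  assume "\<exists>w. set w \<subseteq> pm G X \<and> list_prod G w = g"
  then obtain w where "set w \<subseteq> pm G X" "list_prod G w = g" by blast
  then show "g \<in> generate G X"
    by (induction w arbitrary: g) (auto simp: pm_def intro: generate.intros)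
qed

end

section \<open>Free generation\<close>

locale free_basis = group G for G (structure) +
  fixes X :: "'a set"
  assumes basis: "basis G X"
begin

lemma basis_subset: "X \<subseteq> carrier G"
  using basis by (simp add: basis_def)

lemma letter_closed: "a \<in> pm G X \<Longrightarrow> a \<in> carrier G"
  using pm_carrier[OF basis_subset] by blast

lemma word_closed: "set w \<subseteq> pm G X \<Longrightarrow> set w \<subseteq> carrier G"
  using letter_closed by blast

lemma inv_letter: "a \<in> pm G X \<Longrightarrow> inv a \<in> pm G X"
  using inv_pm[OF basis_subset] .

lemma no_formal_relation:
  "fst ` set w \<subseteq> X \<Longrightarrow> reduced_word w \<Longrightarrow> w \<noteq> [] \<Longrightarrow> list_prod G (map (letter_val G) w) \<noteq> \<one>"
  using basis by (simp add: basis_def)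

text \<open>The formal word \<open>x \<cdot> x\<^sup>-\<^sup>1\<close> in two generators is reduced, so it cannot be trivial. This also
  excludes \<open>x = x\<^sup>-\<^sup>1\<close>.\<close>

lemma inv_not_in_basis:
  assumes "x \<in> X"
  shows "inv x \<notin> X"
proof
  assume "inv x \<in> X"
  then have "list_prod G (map (letter_val G) [(x, True), (inv x, True)]) \<noteq> \<one>"
    using assms by (intro no_formal_relation) (auto simp: reduced_word_def less_Suc_eq)
  then show False using assms basis_subset by (auto simp: letter_val_def)
qed

lemma inv_letter_neq: "a \<in> pm G X \<Longrightarrow> inv a \<noteq> a"
  using inv_not_in_basis[of a] inv_not_in_basis[of "inv a"] basis_subset by (auto simp: pm_def)

lemma no_relation:
  assumes "set w \<subseteq> pm G X" "free_reduced G w" "w \<noteq> []"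
  shows "list_prod G w \<noteq> \<one>"
proof -
  define f where "f a = (if a \<in> X then (a, True) else (inv a, False))" for a
  have val: "letter_val G (f a) = a" if "a \<in> pm G X" for a
    using that basis_subset by (auto simp: f_def letter_val_def pm_def)
  have "reduced_word (map f w)"
    unfolding reduced_word_def
  proof (intro allI impI)
    fix i assume i: "Suc i < length (map f w)"
    have "inv (w ! i) \<noteq> w ! Suc i"
      using i assms(2) by (simp add: free_reduced_def successively_conv_nth)
    moreover have "w ! i \<in> carrier G" "w ! Suc i \<in> carrier G"
      using i word_closed[OF assms(1)] by (auto simp: subset_code(1))
    ultimately show "\<not> (fst (map f w ! i) = fst (map f w ! Suc i) \<and>
        snd (map f w ! i) \<noteq> snd (map f w ! Suc i))"
      using i by (auto simp: f_def)
  qed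
  moreover have "fst (f a) \<in> X" if "a \<in> pm G X" for a
    using that basis_subset by (auto simp: f_def pm_def)
  then have "fst ` set (map f w) \<subseteq> X" using assms(1) by auto
  moreover have "map (letter_val G) (map f w) = w"
    using assms(1) val by (auto simp: subset_iff intro: map_idI)
  ultimately show ?thesis using no_formal_relation[of "map f w"] assms(3) by simp
qed

lemma letter_neq_one: "a \<in> pm G X \<Longrightarrow> a \<noteq> \<one>"
  using no_relation[of "[a]"] letter_closed by (auto simp: free_reduced_def)

lemma free_reduced_inv_word:
  assumes "set w \<subseteq> pm G X" "free_reduced G w"
  shows "free_reduced G (inv_word G w)"
  unfolding free_reduced_def inv_word_def successively_map successively_rev
proof (rule successively_mono)
  show "successively (\<lambda>a b. inv a \<noteq> b) w" using assms(2) by (simp add: free_reduced_def)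
  show "inv (inv b) \<noteq> inv a" if "a \<in> set w" "b \<in> set w" "inv a \<noteq> b" for a b
    using that assms(1) letter_closed by auto
qed

lemma exists_word:
  assumes "g \<in> carrier G"
  shows "\<exists>w. set w \<subseteq> pm G X \<and> list_prod G w = g"
  using assms basis generate_conv_words[OF basis_subset, of g] by (simp add: basis_def)

text \<open>After stripping common last letters of \<open>v\<close> and \<open>w\<close>, the word \<open>v w\<^sup>-\<^sup>1\<close> is reduced and hence
  nontrivial unless it is empty.\<close>

lemma reduced_word_unique:
  assumes "set v \<subseteq> pm G X" "set w \<subseteq> pm G X" "free_reduced G v" "free_reduced G w"
    and "list_prod G v = list_prod G w"
  shows "v = w"
  using assms
proof (induction v arbitrary: w rule: rev_induct)
  case Nil
  then show ?case using no_relation[of w] by auto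
next
  case (snoc a v)
  note va = snoc.prems
  show ?case
  proof (cases w rule: rev_cases)
    case Nil
    then show ?thesis using no_relation[of "v @ [a]"] va by auto
  next
    case (snoc u b)
    have cl: "set v \<subseteq> carrier G" "set u \<subseteq> carrier G" "a \<in> carrier G" "b \<in> carrier G"
      using va snoc letter_closed by auto
    show ?thesis
    proof (cases "a = b")
      case True
      have "list_prod G v = list_prod G u"
        using va(5) cl unfolding snoc True by (simp add: list_prod_append)
      then have "v = u"
        using snoc.IH[of u] va unfolding snoc
        by (auto simp: free_reduced_def successively_append_iff)
      then show ?thesis using snoc True by simp
    next
      case False
      let ?r = "v @ a # inv b # inv_word G u"
      have ub: "inv_word G (u @ [b]) = inv b # inv_word G u" by (simp add: inv_word_def)
      have r: "free_reduced G (inv b # inv_word G u)"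
        using free_reduced_inv_word[of "u @ [b]"] va unfolding snoc ub by simp
      have "inv a \<noteq> inv b" using False cl by (metis inv_inv)
      then have "free_reduced G ?r"
        using va(3) r by (auto simp: free_reduced_def successively_append_iff successively_Cons)
      moreover have sr: "set ?r \<subseteq> pm G X"
        using va(1,2) snoc inv_letter set_inv_word[OF basis_subset, of u] by auto
      moreover have "list_prod G ?r = \<one>"
      proof -
        have "?r = (v @ [a]) @ inv_word G (u @ [b])" by (simp add: ub)
        moreover have "set (v @ [a]) \<subseteq> carrier G" "set (inv_word G (u @ [b])) \<subseteq> carrier G"
          "set w \<subseteq> carrier G"
          using word_closed[OF sr] ub word_closed[OF va(2)] by auto
        ultimately show ?thesis
          using va(5) snoc by (simp only: list_prod_append list_prod_inv_word list_prod_closed r_inv)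
      qed
      ultimately show ?thesis using no_relation[of ?r] by simp
    qed
  qed
qed

text \<open>The universal property of a basis. The letters of \<open>v v'\<^sup>-\<^sup>1\<close> cancel completely when \<open>v\<close> and
  \<open>v'\<close> spell the same element, so the image of a spelling does not depend on its choice.\<close>

lemma exists_hom:
  assumes "group K" and k: "\<And>a. a \<in> pm G X \<Longrightarrow> k a \<in> carrier K"
    and inv: "\<And>a. a \<in> pm G X \<Longrightarrow> k (inv a) = inv\<^bsub>K\<^esub> k a"
  shows "\<exists>\<psi> \<in> hom G K. \<forall>a \<in> pm G X. \<psi> a = k a"
proof -
  interpret K: group K by fact
  have kw: "set (map k w) \<subseteq> carrier K" if "set w \<subseteq> pm G X" for w
    using that k by auto
  have kinv: "map k (inv_word G w) = inv_word K (map k w)" if "set w \<subseteq> pm G X" for w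
    using that inv by (auto simp: inv_word_def rev_map)
  have unique: "list_prod K (map k v) = list_prod K (map k w)"
    if v: "set v \<subseteq> pm G X" and w: "set w \<subseteq> pm G X" and eq: "list_prod G v = list_prod G w" for v w
  proof -
    let ?r = "v @ inv_word G w"
    have r: "set ?r \<subseteq> pm G X" using v set_inv_word[OF basis_subset w] by simp
    have "list_prod G ?r = \<one>"
      using eq word_closed[OF v] word_closed[OF w] word_closed[OF r]
      by (simp add: list_prod_append list_prod_inv_word)
    then have "list_prod G (free_reduce G ?r) = \<one>"
      using word_closed[OF r] by (simp only: list_prod_free_reduce)
    then have "free_reduce G ?r = []"
      using no_relation[of "free_reduce G ?r"] set_free_reduce[of G ?r] r free_reduced_free_reduce
      by blast
    then have "list_prod K (map k ?r) = \<one>\<^bsub>K\<^esub>"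
      using K.list_prod_map_free_reduce[of ?r "pm G X" k G] r k inv by simp
    then have "list_prod K (map k v) \<otimes>\<^bsub>K\<^esub> inv\<^bsub>K\<^esub> list_prod K (map k w) = \<one>\<^bsub>K\<^esub>"
      using kw[OF v] kw[OF w] kw[OF set_inv_word[OF basis_subset w]]
      by (simp add: K.list_prod_append K.list_prod_inv_word kinv[OF w])
    then show ?thesis
      using kw[OF v] kw[OF w] K.inv_solve_right'[of "\<one>\<^bsub>K\<^esub>"] by simp
  qed
  define \<psi> where "\<psi> g = list_prod K (map k (SOME w. set w \<subseteq> pm G X \<and> list_prod G w = g))" for g
  have \<psi>: "\<psi> (list_prod G w) = list_prod K (map k w)" if "set w \<subseteq> pm G X" for w
  proof -
    have "\<exists>v. set v \<subseteq> pm G X \<and> list_prod G v = list_prod G w" using that by blast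
    from someI_ex[OF this] show ?thesis unfolding \<psi>_def using unique that by blast
  qed
  have "\<psi> \<in> hom G K"
  proof (rule homI)
    fix g h assume "g \<in> carrier G" "h \<in> carrier G"
    then obtain v w where vw: "set v \<subseteq> pm G X" "list_prod G v = g" "set w \<subseteq> pm G X" "list_prod G w = h"
      using exists_word by metis
    show "\<psi> g \<in> carrier K" using \<psi>[OF vw(1)] vw(2) kw[OF vw(1)] by simp
    have "\<psi> (list_prod G (v @ w)) = list_prod K (map k (v @ w))"
      using vw by (intro \<psi>) simp
    then show "\<psi> (g \<otimes> h) = \<psi> g \<otimes>\<^bsub>K\<^esub> \<psi> h"
      using vw \<psi>[OF vw(1)] \<psi>[OF vw(3)] kw[OF vw(1)] kw[OF vw(3)] word_closed
      by (simp add: list_prod_append K.list_prod_append)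
  qed
  moreover have "\<psi> a = k a" if "a \<in> pm G X" for a
    using \<psi>[of "[a]"] that k letter_closed by simp
  ultimately show ?thesis by blast
qed

end

section \<open>Whitehead transformations\<close>

definition whitehead_map :: "('a, 'b) monoid_scheme \<Rightarrow> 'a \<Rightarrow> ('a \<Rightarrow> int) \<Rightarrow> 'a \<Rightarrow> 'a" where
  "whitehead_map G y \<chi> x = y [^]\<^bsub>G\<^esub> (- \<chi> x) \<otimes>\<^bsub>G\<^esub> x \<otimes>\<^bsub>G\<^esub> y [^]\<^bsub>G\<^esub> \<chi> (inv\<^bsub>G\<^esub> x)"

context group
begin

lemma whitehead_map_closed [simp]:
  "y \<in> carrier G \<Longrightarrow> x \<in> carrier G \<Longrightarrow> whitehead_map G y \<chi> x \<in> carrier G"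
  by (simp add: whitehead_map_def)

lemma whitehead_map_inv:
  "y \<in> carrier G \<Longrightarrow> x \<in> carrier G \<Longrightarrow> whitehead_map G y \<chi> (inv x) = inv (whitehead_map G y \<chi> x)"
  by (simp add: whitehead_map_def inv_mult_group m_assoc int_pow_neg)

lemma int_pow_conj_self:
  assumes "y \<in> carrier G"
  shows "y [^] (- i :: int) \<otimes> y \<otimes> y [^] i = y" "y [^] (- i :: int) \<otimes> inv y \<otimes> y [^] i = inv y"
proof -
  have "y [^] (- i) \<otimes> y [^] (1 :: int) \<otimes> y [^] i = y [^] (1 :: int)"
    "y [^] (- i) \<otimes> y [^] (- 1 :: int) \<otimes> y [^] i = y [^] (- 1 :: int)"
    using assms by (simp_all only: int_pow_mult[symmetric]) simp_all
  then show "y [^] (- i :: int) \<otimes> y \<otimes> y [^] i = y"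
    "y [^] (- i :: int) \<otimes> inv y \<otimes> y [^] i = inv y"
    using assms by (simp_all add: int_pow_neg)
qed

lemma whitehead_map_fixes:
  assumes "y \<in> carrier G" "\<chi> (inv y) = \<chi> y"
  shows "whitehead_map G y \<chi> y = y" "whitehead_map G y \<chi> (inv y) = inv y"
  using assms int_pow_conj_self[OF assms(1), of "\<chi> y"] by (simp_all add: whitehead_map_def)

lemma whitehead_map_undo:
  assumes "y \<in> carrier G" "x \<in> carrier G"
  shows "y [^] \<chi> x \<otimes> whitehead_map G y \<chi> x \<otimes> y [^] (- \<chi> (inv x)) = x"
proof -
  have "y [^] \<chi> x \<otimes> whitehead_map G y \<chi> x \<otimes> y [^] (- \<chi> (inv x)) =
    (y [^] \<chi> x \<otimes> y [^] (- \<chi> x)) \<otimes> x \<otimes> (y [^] \<chi> (inv x) \<otimes> y [^] (- \<chi> (inv x)))"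
    using assms by (simp add: whitehead_map_def m_assoc)
  then show ?thesis using assms by (simp add: int_pow_neg)
qed

end

context free_basis
begin

text \<open>The inverse transformation \<open>x \<mapsto> y\<^bsup>\<chi>(x)\<^esup> x y\<^bsup>-\<chi>(x\<^sup>-\<^sup>1)\<^esup>\<close> extends to an endomorphism \<open>\<psi>\<close>
  because \<open>X\<close> is a basis. As both fix \<open>y\<close>, \<open>\<psi>\<close> carries the image \<open>X'\<close> of \<open>X\<close> back to \<open>X\<close>
  letter by letter, and thereby every relation between the elements of \<open>X'\<close> to the same
  relation between those of \<open>X\<close>.\<close>

lemma basis_whitehead_map:
  assumes y: "y \<in> pm G X" and \<chi>: "\<chi> (inv y) = \<chi> y"
  shows "basis G (whitehead_map G y \<chi> ` X)"
proof -
  let ?T = "whitehead_map G y \<chi>"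
  let ?X = "?T ` X"
  have yc: "y \<in> carrier G" using y letter_closed by blast
  have X: "X \<subseteq> carrier G" by (rule basis_subset)
  have X': "?X \<subseteq> carrier G" using X yc by auto
  have sub: "subgroup (generate G ?X) G" using X' by (rule generate_is_subgroup)
  have fix_y: "?T y = y" "?T (inv y) = inv y" using whitehead_map_fixes yc \<chi> by auto
  have ygen: "y \<in> generate G ?X"
  proof (cases "y \<in> X")
    case True
    then show ?thesis using fix_y by (metis generate.incl imageI)
  next
    case False
    then have "inv y \<in> X" using y X by (auto simp: pm_def)
    then have "inv y \<in> ?X" using fix_y by (metis imageI)
    then show ?thesis using generate.inv[of "inv y" ?X G] yc by simp
  qed
  have "X \<subseteq> generate G ?X"
  proof
    fix x assume x: "x \<in> X"
    then have "?T x \<in> generate G ?X" by (intro generate.incl imageI)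
    then have "y [^] \<chi> x \<otimes> ?T x \<otimes> y [^] (- \<chi> (inv x)) \<in> generate G ?X"
      using ygen sub by (intro generate.eng subgroup_int_pow_closed)
    then show "x \<in> generate G ?X" using whitehead_map_undo[OF yc, of x \<chi>] x X by auto
  qed
  then have "generate G X \<subseteq> generate G ?X" using sub by (rule generate_subgroup_incl)
  then have gen: "generate G ?X = carrier G"
    using basis generate_incl[OF X'] by (auto simp: basis_def)
  have "\<exists>\<psi> \<in> hom G G. \<forall>a \<in> pm G X. \<psi> a = whitehead_map G y (\<lambda>x. - \<chi> x) a"
    by (rule exists_hom[OF is_group]) (use letter_closed yc whitehead_map_inv in auto)
  then obtain \<psi> where \<psi>: "\<psi> \<in> hom G G" "\<And>a. a \<in> pm G X \<Longrightarrow> \<psi> a = whitehead_map G y (\<lambda>x. - \<chi> x) a"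
    by blast
  interpret \<psi>: group_hom G G \<psi>
    by (simp add: group_hom_def group_hom_axioms_def is_group \<psi>(1))
  have \<psi>y: "\<psi> y = y"
    using \<psi>(2)[OF y] whitehead_map_fixes[of y "\<lambda>x. - \<chi> x"] yc \<chi> by simp
  have \<psi>T: "\<psi> (?T x) = x" if "x \<in> X" for x
  proof -
    have x: "x \<in> pm G X" "x \<in> carrier G" using that X by (auto simp: pm_def)
    have "\<psi> (?T x) = y [^] (- \<chi> x) \<otimes> whitehead_map G y (\<lambda>x. - \<chi> x) x \<otimes> y [^] \<chi> (inv x)"
      using x yc \<psi>(2) \<psi>y by (simp add: whitehead_map_def[of _ _ \<chi>] \<psi>.hom_int_pow)
    then show ?thesis using whitehead_map_undo[OF yc x(2), of "\<lambda>x. - \<chi> x"] by simp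
  qed
  have "list_prod G (map (letter_val G) w) \<noteq> \<one>"
    if w: "fst ` set w \<subseteq> ?X" "reduced_word w" "w \<noteq> []" for w
  proof
    assume one: "list_prod G (map (letter_val G) w) = \<one>"
    let ?v = "map (\<lambda>(x, s). (\<psi> x, s)) w"
    have "fst p \<in> carrier G" if "p \<in> set w" for p using that w(1) X' by blast
    then have "map (letter_val G) ?v = map \<psi> (map (letter_val G) w)"
      by (simp add: letter_val_def case_prod_unfold)
    moreover have "list_prod G (map \<psi> u) = \<psi> (list_prod G u)" if "set u \<subseteq> carrier G" for u
      using that by (induction u) auto
    moreover have "set (map (letter_val G) w) \<subseteq> carrier G"
      using w(1) X' by (auto simp: letter_val_def)
    ultimately have "list_prod G (map (letter_val G) ?v) = \<one>" by (metis one \<psi>.hom_one)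
    moreover have "fst ` set ?v \<subseteq> X" using w(1) \<psi>T by force
    moreover have "reduced_word ?v"
      unfolding reduced_word_def
    proof (intro allI impI)
      fix i assume i: "Suc i < length ?v"
      then have "fst (w ! i) \<in> ?X" "fst (w ! Suc i) \<in> ?X" using w(1) by auto
      then have "\<psi> (fst (w ! i)) = \<psi> (fst (w ! Suc i)) \<longleftrightarrow> fst (w ! i) = fst (w ! Suc i)"
        using \<psi>T by auto
      then show "\<not> (fst (?v ! i) = fst (?v ! Suc i) \<and> snd (?v ! i) \<noteq> snd (?v ! Suc i))"
        using i w(2) by (auto simp: reduced_word_def case_prod_unfold)
    qed
    ultimately show False using no_formal_relation[of ?v] w(3) by simp
  qed
  then show ?thesis using X' gen by (simp add: basis_def)
qed

end

section \<open>Conjugacy and spellings\<close>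

definition cyc_reduced :: "('a, 'b) monoid_scheme \<Rightarrow> 'a list \<Rightarrow> bool" where
  "cyc_reduced G w \<longleftrightarrow> w \<noteq> [] \<and> free_reduced G w \<and> inv\<^bsub>G\<^esub> (last w) \<noteq> hd w"

lemma cyc_reduced_rotate1: "cyc_reduced G w \<Longrightarrow> cyc_reduced G (rotate1 w)"
proof (cases w)
  case (Cons a u)
  assume "cyc_reduced G w"
  then show ?thesis
    unfolding Cons by (cases u)
      (auto simp: cyc_reduced_def free_reduced_def successively_append_iff successively_Cons
        hd_append split: if_splits)
qed (simp add: cyc_reduced_def)

lemma rotate_back: "\<exists>n. v = rotate n (rotate1 v)"
proof (cases "v = []")
  case False
  then have "rotate (length v - 1) (rotate1 v) = v"
    using rotate_conv_mod[of "length v" v]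
    by (simp add: rotate1_rotate_swap[symmetric] rotate_Suc[symmetric])
  then show ?thesis by metis
qed simp

context group
begin

lemma conj_mult:
  assumes "a \<in> carrier G" "b \<in> carrier G" "c \<in> carrier G"
  shows "(a \<otimes> b) \<otimes> c \<otimes> inv (a \<otimes> b) = a \<otimes> (b \<otimes> c \<otimes> inv b) \<otimes> inv a"
  using assms by (simp add: inv_mult_group m_assoc)

lemma conj_class_self: "g \<in> carrier G \<Longrightarrow> g \<in> conj_class G g"
  unfolding conj_class_def by (auto intro!: exI[of _ \<one>])

lemma conj_class_subset: "g \<in> carrier G \<Longrightarrow> conj_class G g \<subseteq> carrier G"
  by (auto simp: conj_class_def)

lemma conj_class_conj:
  assumes "g \<in> carrier G" "h \<in> conj_class G g" "f \<in> carrier G"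
  shows "f \<otimes> h \<otimes> inv f \<in> conj_class G g"
proof -
  obtain k where k: "k \<in> carrier G" "h = k \<otimes> g \<otimes> inv k"
    using assms(2) by (auto simp: conj_class_def)
  then have "f \<otimes> h \<otimes> inv f = (f \<otimes> k) \<otimes> g \<otimes> inv (f \<otimes> k)"
    using assms conj_mult by simp
  then show ?thesis using k assms by (auto simp: conj_class_def)
qed

lemma conj_class_sym:
  assumes "g \<in> carrier G" "h \<in> conj_class G g"
  shows "g \<in> conj_class G h"
proof -
  obtain k where k: "k \<in> carrier G" "h = k \<otimes> g \<otimes> inv k"
    using assms(2) by (auto simp: conj_class_def)
  then have "inv k \<otimes> h \<otimes> inv (inv k) = g"
    using assms conj_mult[of "inv k" k g] by simp
  then show ?thesis using k unfolding conj_class_def by (auto intro!: exI[of _ "inv k"])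
qed

lemma conj_class_eq:
  assumes "g \<in> carrier G" "h \<in> conj_class G g"
  shows "conj_class G h = conj_class G g"
proof -
  have h: "h \<in> carrier G" using assms conj_class_subset by blast
  show ?thesis
    using conj_class_conj[OF assms] conj_class_conj[OF h conj_class_sym[OF assms]]
    unfolding conj_class_def by blast
qed

lemma one_in_conj_class:
  assumes "g \<in> carrier G" "\<one> \<in> conj_class G g"
  shows "g = \<one>"
  using conj_class_sym[OF assms] by (auto simp: conj_class_def)

end

context free_basis
begin

text \<open>Conjugating a cyclically reduced \<open>u\<close> by a letter \<open>a\<close> either rotates it, when \<open>a\<close> cancels
  at one of its ends, or yields a reduced word whose outer letters are inverse to each other.
  In the latter case further reduced conjugation never becomes cyclically reduced.\<close>

lemma conj_cyc_reduced_rotate: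
  assumes "set g \<subseteq> pm G X" "free_reduced G g"
    and "set u \<subseteq> pm G X" "cyc_reduced G u" "set v \<subseteq> pm G X" "cyc_reduced G v"
    and "list_prod G v = list_prod G g \<otimes> list_prod G u \<otimes> inv (list_prod G g)"
  shows "\<exists>n. v = rotate n u"
  using assms
proof (induction g arbitrary: u rule: rev_induct)
  case Nil
  then have "v = u"
    using reduced_word_unique[of v u] word_closed[of u] by (simp add: cyc_reduced_def)
  then show ?case by (intro exI[of _ 0]) simp
next
  case (snoc a g)
  note prems = snoc.prems
  have cl: "a \<in> carrier G" "set g \<subseteq> carrier G" "set u \<subseteq> carrier G"
    using prems(1,3) letter_closed by auto
  have une: "u \<noteq> []" using prems(4) by (simp add: cyc_reduced_def)
  have g: "set g \<subseteq> pm G X" "free_reduced G g"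
    using prems(1,2) by (auto simp: free_reduced_def successively_append_iff)
  have val: "list_prod G v = list_prod G g \<otimes> (a \<otimes> list_prod G u \<otimes> inv a) \<otimes> inv (list_prod G g)"
    using prems(7) cl by (simp add: list_prod_append conj_mult)
  consider "hd u = inv a" | "last u = a" | "hd u \<noteq> inv a" "last u \<noteq> a" by blast
  then show ?case
  proof cases
    case 1
    then obtain u' where u: "u = inv a # u'" using une by (cases u) auto
    have "a \<otimes> list_prod G u \<otimes> inv a = list_prod G (rotate1 u)"
      using cl unfolding u by (simp add: list_prod_append m_assoc[symmetric])
    then have "\<exists>n. v = rotate n (rotate1 u)"
      using snoc.IH[OF g, of "rotate1 u"] prems val by (simp add: cyc_reduced_rotate1)
    then show ?thesis by (metis rotate1_rotate_swap rotate_Suc)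
  next
    case 2
    define u' where "u' = a # butlast u"
    have u: "u = butlast u @ [a]" using 2 une by (metis append_butlast_last_id)
    have u': "rotate1 u' = u" using u by (simp add: u'_def)
    have "set (butlast u) \<subseteq> carrier G" using cl(3) by (meson in_set_butlastD subset_iff)
    then have "a \<otimes> list_prod G u \<otimes> inv a = list_prod G u'"
      using cl list_prod_append[of "butlast u" "[a]"] unfolding u'_def
      by (subst u) (simp add: m_assoc)
    moreover have "cyc_reduced G u'"
    proof -
      have "free_reduced G (butlast u @ [a])" "inv a \<noteq> hd (butlast u @ [a])"
        using prems(4) u unfolding cyc_reduced_def by (metis last_snoc)+
      then show ?thesis
        using prems(4) inv_letter_neq[of a] prems(1) unfolding u'_def cyc_reduced_def free_reduced_def
        by (auto simp: successively_append_iff successively_Cons)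
    qed
    moreover have "set u' \<subseteq> pm G X" using prems(3) u' by (metis set_rotate1)
    ultimately obtain n where "v = rotate n u'"
      using snoc.IH[OF g, of u'] prems val by auto
    moreover obtain m where "u' = rotate m u" using rotate_back[of u'] u' by auto
    ultimately show ?thesis by (auto simp: rotate_rotate)
  next
    case 3
    let ?w = "(g @ [a]) @ u @ inv_word G (g @ [a])"
    have iw: "inv_word G (g @ [a]) = inv a # inv_word G g" by (simp add: inv_word_def)
    have "free_reduced G (inv_word G (g @ [a]))"
      using free_reduced_inv_word prems(1,2) by blast
    moreover have "inv (last u) \<noteq> inv a"
      using 3(2) cl(1) cl(3) une by (metis inv_inv last_in_set subsetD)
    ultimately have "free_reduced G ?w"
      using prems(2,4) 3(1) une unfolding iw cyc_reduced_def
      by (auto simp: free_reduced_def successively_append_iff successively_Cons)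
    moreover have sw: "set ?w \<subseteq> pm G X"
      using prems(1,3) set_inv_word[OF basis_subset prems(1)] by auto
    moreover have "list_prod G ?w = list_prod G v"
    proof -
      have "set (g @ [a]) \<subseteq> carrier G" "set (inv_word G (g @ [a])) \<subseteq> carrier G"
        using word_closed[OF sw] by auto
      then show ?thesis
        using prems(7) cl list_prod_inv_word[of "g @ [a]"]
        by (simp only: list_prod_append[OF \<open>set (g @ [a]) \<subseteq> carrier G\<close>] list_prod_append
            list_prod_closed m_assoc m_closed inv_closed set_append Un_subset_iff)
    qed
    ultimately have "v = ?w"
      using reduced_word_unique[of v ?w] prems(5,6) by (simp add: cyc_reduced_def)
    moreover have "last ?w = inv (hd (g @ [a]))"
      by (cases g) (auto simp: inv_word_def)
    moreover have "hd ?w = hd (g @ [a])" by (cases g) auto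
    moreover have "hd (g @ [a]) \<in> carrier G" using cl by (cases g) auto
    ultimately have "inv (last v) = hd v" by simp
    then show ?thesis using prems(6) by (simp add: cyc_reduced_def)
  qed
qed

lemma cyclic_reduction:
  assumes "set w \<subseteq> pm G X" "free_reduced G w" "w \<noteq> []"
  shows "\<exists>g v. set g \<subseteq> pm G X \<and> cyc_reduced G v \<and> set v \<subseteq> set w \<and> length v \<le> length w \<and>
    list_prod G w = list_prod G g \<otimes> list_prod G v \<otimes> inv (list_prod G g)"
  using assms
proof (induction "length w" arbitrary: w rule: less_induct)
  case less
  note prems = less.prems
  have cw: "set w \<subseteq> carrier G" using word_closed[OF prems(1)] .
  show ?case
  proof (cases "inv (last w) = hd w")
    case False
    then show ?thesis using prems cw
      by (intro exI[of _ "[]"] exI[of _ w]) (auto simp: cyc_reduced_def)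
  next
    case True
    obtain a u where w: "w = a # u" using prems(3) by (cases w) auto
    have a: "a \<in> pm G X" "a \<in> carrier G" using prems(1) cw w by auto
    have "u \<noteq> []" using True inv_letter_neq[OF a(1)] w by auto
    then obtain m b where u: "u = m @ [b]" by (cases u rule: rev_cases) auto
    have "b \<in> carrier G" using cw w u by auto
    then have b: "b = inv a" using True w u by auto
    have m: "set m \<subseteq> pm G X" "free_reduced G m" "set m \<subseteq> carrier G"
      using prems(1,2) cw unfolding w u
      by (auto simp: free_reduced_def successively_append_iff successively_Cons)
    have "m \<noteq> []" using prems(2) a unfolding w u b by (auto simp: free_reduced_def)
    then obtain g v where gv: "set g \<subseteq> pm G X" "cyc_reduced G v" "set v \<subseteq> set m" "length v \<le> length m"
      "list_prod G m = list_prod G g \<otimes> list_prod G v \<otimes> inv (list_prod G g)"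
      using less.hyps[of m] m w u by auto
    have "set v \<subseteq> carrier G" using gv(3) m(3) by blast
    moreover have "list_prod G w = a \<otimes> list_prod G m \<otimes> inv a"
      unfolding w u b using m(3) a by (simp add: list_prod_append m_assoc)
    ultimately have "list_prod G w = list_prod G (a # g) \<otimes> list_prod G v \<otimes> inv (list_prod G (a # g))"
      using gv(5) word_closed[OF gv(1)] a conj_mult[of a "list_prod G g" "list_prod G v"] by simp
    then show ?thesis
      using gv a w u by (intro exI[of _ "a # g"] exI[of _ v]) auto
  qed
qed

lemma is_spelling_Elt:
  assumes "g \<noteq> \<one>"
  shows "is_spelling G X (Elt g) w \<longleftrightarrow> set w \<subseteq> pm G X \<and> list_prod G w = g \<and> free_reduced G w"
proof -
  have "(\<forall>i \<le> length w. inv (bordered G (Elt g) w ! i) \<noteq> bordered G (Elt g) w ! Suc i)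
      \<longleftrightarrow> successively (\<lambda>a b. inv a \<noteq> b) (\<one> # w @ [\<one>])"
    by (simp add: successively_conv_nth less_Suc_eq_le)
  also have "\<dots> \<longleftrightarrow> free_reduced G w" if "set w \<subseteq> pm G X" "w \<noteq> []"
  proof -
    have "hd w \<in> pm G X" "last w \<in> pm G X" using that by auto
    then have "hd w \<noteq> \<one>" "inv (last w) \<noteq> \<one>" using letter_neq_one inv_letter by auto
    then show ?thesis
      using that(2) by (auto simp: free_reduced_def successively_append_iff successively_Cons)
  qed
  finally show ?thesis using assms by (cases "w = []") (auto simp: is_spelling_def)
qed

lemma is_spelling_Cls:
  assumes "\<one> \<notin> C"
  shows "is_spelling G X (Cls C) w \<longleftrightarrow> set w \<subseteq> pm G X \<and> list_prod G w \<in> C \<and> cyc_reduced G w"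
proof -
  have "(\<forall>i \<le> length w. inv (bordered G (Cls C) w ! i) \<noteq> bordered G (Cls C) w ! Suc i)
      \<longleftrightarrow> successively (\<lambda>a b. inv a \<noteq> b) (last w # w @ [hd w])"
    by (simp add: successively_conv_nth less_Suc_eq_le)
  also have "\<dots> \<longleftrightarrow> cyc_reduced G w" if "w \<noteq> []"
    using that by (auto simp: cyc_reduced_def free_reduced_def successively_append_iff successively_Cons)
  finally show ?thesis using assms by (cases "w = []") (auto simp: is_spelling_def)
qed

lemma nontrivial_itemE:
  assumes "r \<in> nontrivial_items G"
  obtains (Elt) g where "r = Elt g" "g \<in> carrier G" "g \<noteq> \<one>"
  | (Cls) g where "r = Cls (conj_class G g)" "g \<in> carrier G" "g \<noteq> \<one>" "\<one> \<notin> conj_class G g"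
  using assms one_in_conj_class unfolding nontrivial_items_def by blast

text \<open>This gives both the existence of spellings and, with their uniqueness up to rotation, the
  fact that no word in the letters represents an item with fewer letters than a spelling. All later
  length estimates only exhibit some word.\<close>

lemma spelling_of_word:
  assumes r: "r \<in> nontrivial_items G" and w: "set w \<subseteq> pm G X" "represents G w r"
  shows "\<exists>v. is_spelling G X r v \<and> length v \<le> length w"
proof -
  let ?u = "free_reduce G w"
  have u: "set ?u \<subseteq> pm G X" "free_reduced G ?u" "length ?u \<le> length w"
    "list_prod G ?u = list_prod G w"
    using set_free_reduce[of G w] w length_free_reduce free_reduced_free_reduce
      list_prod_free_reduce word_closed by auto
  from r show ?thesis
  proof (cases rule: nontrivial_itemE)
    case (Elt g)
    then show ?thesis using u w is_spelling_Elt by auto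
  next
    case (Cls g)
    have "?u \<noteq> []" using Cls w u(4) by auto
    then obtain f v where fv: "set f \<subseteq> pm G X" "cyc_reduced G v" "set v \<subseteq> set ?u" "length v \<le> length ?u"
      "list_prod G ?u = list_prod G f \<otimes> list_prod G v \<otimes> inv (list_prod G f)"
      using cyclic_reduction[OF u(1,2)] by blast
    have v: "set v \<subseteq> pm G X" using fv u by blast
    have fc: "list_prod G f \<in> carrier G" "list_prod G v \<in> carrier G"
      using word_closed[OF v] word_closed[OF fv(1)] by auto
    then have "list_prod G ?u \<in> conj_class G (list_prod G v)"
      using fv(5) by (auto simp: conj_class_def)
    then have "list_prod G v \<in> conj_class G (list_prod G ?u)"
      using conj_class_sym fc by blast
    moreover have "conj_class G (list_prod G ?u) = conj_class G g"
      using conj_class_eq[of g] Cls w u(4) by simp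
    ultimately have "is_spelling G X r v" using is_spelling_Cls Cls v fv by simp
    then show ?thesis using fv(4) u(3) by auto
  qed
qed

lemma exists_spelling:
  assumes r: "r \<in> nontrivial_items G"
  shows "\<exists>v. is_spelling G X r v"
proof -
  have "\<exists>w. set w \<subseteq> pm G X \<and> represents G w r"
    using r
  proof (cases rule: nontrivial_itemE)
    case (Elt g)
    then show ?thesis using exists_word[of g] by auto
  next
    case (Cls g)
    then show ?thesis using exists_word[of g] conj_class_self[of g] by auto
  qed
  then show ?thesis using spelling_of_word[OF r] by blast
qed

text \<open>Consequently the length and the set of letters of an item do not depend on the spelling.\<close>

lemma spelling_unique_rotate:
  assumes r: "r \<in> nontrivial_items G" and v: "is_spelling G X r v" and w: "is_spelling G X r w"
  shows "\<exists>n. w = rotate n v"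
  using r
proof (cases rule: nontrivial_itemE)
  case (Elt g)
  then have "w = v" using v w is_spelling_Elt reduced_word_unique[of w v] by simp
  then show ?thesis by (intro exI[of _ 0]) simp
next
  case (Cls g)
  have vw: "set v \<subseteq> pm G X" "cyc_reduced G v" "list_prod G v \<in> conj_class G g"
    "set w \<subseteq> pm G X" "cyc_reduced G w" "list_prod G w \<in> conj_class G g"
    using v w Cls is_spelling_Cls by auto
  then have "list_prod G w \<in> conj_class G (list_prod G v)"
    using conj_class_eq[of g "list_prod G v"] Cls by simp
  then obtain f where f: "f \<in> carrier G" "list_prod G w = f \<otimes> list_prod G v \<otimes> inv f"
    by (auto simp: conj_class_def)
  obtain u where u: "set u \<subseteq> pm G X" "list_prod G u = f" using exists_word f by blast
  have fr: "set (free_reduce G u) \<subseteq> pm G X" "list_prod G (free_reduce G u) = f"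
    using set_free_reduce[of G u] u list_prod_free_reduce[of u] word_closed[OF u(1)] by auto
  show ?thesis
    using conj_cyc_reduced_rotate[OF fr(1) free_reduced_free_reduce vw(1,2,4,5)] fr(2) f(2) by simp
qed

lemma is_spelling_spelling:
  "r \<in> nontrivial_items G \<Longrightarrow> is_spelling G X r (spelling G X r)"
  unfolding spelling_def using exists_spelling someI_ex by metis

lemma item_length_eq:
  assumes "r \<in> nontrivial_items G" "is_spelling G X r v"
  shows "item_length G X r = length v"
  using spelling_unique_rotate[OF assms is_spelling_spelling[OF assms(1)]]
  by (auto simp: item_length_def)

lemma set_spelling_eq:
  assumes "r \<in> nontrivial_items G" "is_spelling G X r v"
  shows "set (spelling G X r) = set v"
  using spelling_unique_rotate[OF assms is_spelling_spelling[OF assms(1)]] by auto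

lemma item_length_le:
  assumes "r \<in> nontrivial_items G" "set w \<subseteq> pm G X" "represents G w r"
  shows "item_length G X r \<le> length w"
  using spelling_of_word[OF assms] item_length_eq[OF assms(1)] by auto

lemma spelling_nonempty:
  assumes "r \<in> nontrivial_items G" "is_spelling G X r v"
  shows "v \<noteq> []"
  using assms(1)
proof (cases rule: nontrivial_itemE)
  case (Elt g)
  then show ?thesis using assms(2) is_spelling_Elt[of g v] by auto
next
  case (Cls g)
  then show ?thesis using assms(2) is_spelling_Cls[of "conj_class G g" v] by (auto simp: cyc_reduced_def)
qed

end

section \<open>The finest partition\<close>

text \<open>The finest partition is the common refinement of all admissible ones. Each of these has a
  block containing the support of \<open>r\<close>, and the intersection of such blocks is a block of the
  refinement because the support is nonempty.\<close>

lemma finest_partition_props: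
  assumes "\<And>r. r \<in> R \<Longrightarrow> support G X r \<noteq> {}"
  shows "admissible_partition G X R (finest_partition G X R)"
    and "admissible_partition G X R Q \<Longrightarrow> refines X (finest_partition G X R) Q"
proof -
  let ?A = "{Q. admissible_partition G X R Q}"
  let ?C = "common_refinement ?A"
  have "\<exists>Q. admissible_partition G X R Q"
  proof (cases "X = {}")
    case True
    then have "R = {}" using assms by (auto simp: support_def)
    then show ?thesis using True
      by (intro exI[of _ "{}"]) (simp add: admissible_partition_def partition_on_empty)
  next
    case False
    then show ?thesis
      by (intro exI[of _ "{X}"])
        (auto simp: admissible_partition_def partition_on_space support_def)
  qed
  then have ne: "?A \<noteq> {}" by blast
  have part: "\<And>Q. Q \<in> ?A \<Longrightarrow> partition_on X Q" by (simp add: admissible_partition_def)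
  have C: "admissible_partition G X R ?C"
    unfolding admissible_partition_def[of G X R ?C]
  proof (intro conjI ballI)
    show "partition_on X ?C" by (rule partition_on_common_refinement) (use part ne in auto)
    fix r assume r: "r \<in> R"
    then have "\<forall>Q \<in> ?A. \<exists>Y. Y \<in> Q \<and> support G X r \<subseteq> Y"
      by (auto simp: admissible_partition_def)
    then obtain f where f: "\<forall>Q \<in> ?A. f Q \<in> Q \<and> support G X r \<subseteq> f Q"
      by (rule bchoice[elim_format]) blast
    then have sub: "support G X r \<subseteq> \<Inter> (f ` ?A)" by blast
    moreover have "\<Inter> (f ` ?A) \<noteq> {}" using sub assms[OF r] by blast
    ultimately show "\<exists>Y \<in> ?C. support G X r \<subseteq> Y"
      using f unfolding common_refinement by blast
  qed
  have finest: "\<forall>Q. admissible_partition G X R Q \<longrightarrow> refines X ?C Q"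
    using refines_common_refinement[OF part] by blast
  have "finest_partition G X R = ?C"
    unfolding finest_partition_def
    by (rule the_equality) (use C finest refines_asym in blast)+
  then show "admissible_partition G X R (finest_partition G X R)"
    and "admissible_partition G X R Q \<Longrightarrow> refines X (finest_partition G X R) Q"
    using C finest by simp_all
qed

context free_basis
begin

lemma support_subset_iff:
  assumes "Y \<subseteq> X" "set (spelling G X r) \<subseteq> pm G X"
  shows "support G X r \<subseteq> Y \<longleftrightarrow> set (spelling G X r) \<subseteq> pm G Y"
proof
  assume sup: "support G X r \<subseteq> Y"
  show "set (spelling G X r) \<subseteq> pm G Y"
  proof
    fix a assume a: "a \<in> set (spelling G X r)"
    then have "a \<in> pm G X" using assms(2) by blast
    then consider "a \<in> X" | "inv a \<in> X" "a \<in> carrier G"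
      using basis_subset by (auto simp: pm_def)
    then show "a \<in> pm G Y"
    proof cases
      case 1
      then have "a \<in> Y" using a sup by (auto simp: support_def pm_def)
      then show ?thesis by (simp add: pm_def)
    next
      case 2
      then have "inv a \<in> Y" using a sup by (auto simp: support_def pm_def)
      then have "inv (inv a) \<in> pm G Y" unfolding pm_def by blast
      then show ?thesis using 2 by simp
    qed
  qed
next
  assume "set (spelling G X r) \<subseteq> pm G Y"
  then show "support G X r \<subseteq> Y"
    using assms(1) inv_not_in_basis basis_subset by (fastforce simp: support_def pm_def)
qed

lemma spelling_letters: "r \<in> nontrivial_items G \<Longrightarrow> set (spelling G X r) \<subseteq> pm G X"
  using is_spelling_spelling by (auto simp: is_spelling_def)

lemma support_nonempty:
  assumes "r \<in> nontrivial_items G"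
  shows "support G X r \<noteq> {}"
proof -
  obtain a where a: "a \<in> set (spelling G X r)"
    using spelling_nonempty[OF assms is_spelling_spelling[OF assms]] by (meson last_in_set)
  then have "a \<in> pm G {}" if "support G X r = {}"
    using support_subset_iff[of "{}" r] spelling_letters[OF assms] that by auto
  then show ?thesis by (auto simp: pm_def)
qed

end

section \<open>The subroutine\<close>

lemma length_bordered: "length (bordered G r w) = length w + 2"
  by (cases r) auto

lemma bordered_nth: "i < length w \<Longrightarrow> bordered G r w ! Suc i = w ! i"
  by (cases r) (auto simp: nth_append)

context group
begin

text \<open>Multiplying \<open>x\<^sub>1 \<dots> x\<^sub>n\<close> out in the pieces \<open>y\<^bsup>-e\<^esup> x y\<^bsup>e'\<^esup>\<close>, where \<open>e\<close> and \<open>e'\<close> are the exponents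
  at the two sides of the letter \<open>x\<close>.\<close>

lemma list_prod_telescope:
  fixes e :: "nat \<Rightarrow> int"
  assumes "y \<in> carrier G" "set w \<subseteq> carrier G"
  shows "list_prod G (map (\<lambda>j. y [^] (- e j) \<otimes> w ! j \<otimes> y [^] e (Suc j)) [0..<length w])
    = y [^] (- e 0) \<otimes> list_prod G w \<otimes> y [^] e (length w)"
  using assms(2)
proof (induction w rule: rev_induct)
  case Nil
  show ?case using assms(1) by (simp add: int_pow_neg)
next
  case (snoc a w)
  let ?f = "\<lambda>w j. y [^] (- e j) \<otimes> w ! j \<otimes> y [^] e (Suc j)"
  let ?n = "length w"
  have cl: "a \<in> carrier G" "set w \<subseteq> carrier G" using snoc.prems by auto
  have f: "set (map (?f w) [0..<?n]) \<subseteq> carrier G"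
    using assms(1) cl(2) by (auto simp: subset_iff)
  have split: "map (?f (w @ [a])) [0..<length (w @ [a])]
      = map (?f w) [0..<?n] @ [y [^] (- e ?n) \<otimes> a \<otimes> y [^] e (Suc ?n)]"
    by (auto simp: nth_append)
  have "list_prod G (map (?f (w @ [a])) [0..<length (w @ [a])])
      = y [^] (- e 0) \<otimes> list_prod G w \<otimes> (y [^] e ?n \<otimes> y [^] (- e ?n)) \<otimes> a \<otimes> y [^] e (Suc ?n)"
    unfolding split using f snoc.IH[OF cl(2)] cl assms(1) by (simp add: list_prod_append m_assoc)
  also have "y [^] e ?n \<otimes> y [^] (- e ?n) = \<one>" using assms(1) by (simp add: int_pow_neg)
  finally show ?case using cl assms(1) by (simp add: list_prod_append m_assoc)
qed

end

context free_basis
begin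

lemma bordered_zpm:
  assumes "r \<in> nontrivial_items G" "is_spelling G X r w" "i \<le> Suc (length w)"
  shows "bordered G r w ! i \<in> zpm G X"
proof -
  have w: "set w \<subseteq> pm G X" "w \<noteq> []"
    using assms spelling_nonempty[OF assms(1,2)] by (auto simp: is_spelling_def)
  have "bordered G r w ! i \<in> set (bordered G r w)"
    using assms(3) length_bordered[of G r w] by (intro nth_mem) simp
  also have "hd w \<in> pm G X" "last w \<in> pm G X" using w by auto
  then have "set (bordered G r w) \<subseteq> zpm G X" using w by (cases r) (auto simp: zpm_def)
  finally show ?thesis .
qed

lemma zpm_closed: "a \<in> zpm G X \<Longrightarrow> a \<in> carrier G"
  using letter_closed by (auto simp: zpm_def)

lemma inv_zpm: "a \<in> zpm G X \<Longrightarrow> inv a \<in> zpm G X"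
  using inv_letter by (auto simp: zpm_def)

text \<open>The two ways in which the first and the last turn are special: for an element they involve
  \<open>1\<close>, which is never the letter \<open>y\<close>, and for a class they coincide.\<close>

lemma bordered_ends:
  assumes "w \<noteq> []"
  shows "bordered G r w ! 0 = \<one> \<and> bordered G r w ! Suc (length w) = \<one> \<or>
    bordered G r w ! 0 = bordered G r w ! length w \<and>
    bordered G r w ! Suc (length w) = bordered G r w ! Suc 0"
proof (cases r)
  case (Cls C)
  moreover have "last w = w ! (length w - 1)" "hd w = w ! 0"
    using assms by (simp_all add: last_conv_nth hd_conv_nth)
  ultimately show ?thesis using assms by (simp add: nth_append nth_Cons')
qed (simp add: nth_append)

text \<open>The exponents \<open>-\<chi>(x)\<close> and \<open>\<chi>(x\<^sup>-\<^sup>1)\<close> have opposite signs throughout, so only one of \<open>y\<close> and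
  \<open>y\<^sup>-\<^sup>1\<close> occurs on each side; \<open>l\<close> decides which of them is the letter of the neighbour relation.\<close>

lemma whitehead_neighbour_map:
  assumes y: "y \<in> pm G X" and fix_y: "\<chi> (inv y) = \<chi> y"
    and l: "l = 0 \<or> l = - 1" and \<chi>: "\<And>a. a \<in> pm G X \<Longrightarrow> \<chi> a = l \<or> \<chi> a = l + 1"
  shows "whitehead_neighbour G X (whitehead_map G y \<chi> ` X)"
proof -
  let ?X = "whitehead_map G y \<chi> ` X"
  have yc: "y \<in> carrier G" using y letter_closed by blast
  have "whitehead_map G y \<chi> y = y" "whitehead_map G y \<chi> (inv y) = inv y"
    using whitehead_map_fixes yc fix_y by auto
  then have "y \<in> X \<Longrightarrow> y \<in> ?X" "inv y \<in> X \<Longrightarrow> inv y \<in> ?X"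
    by (metis imageI)+
  moreover have "y \<in> X \<or> inv y \<in> X" using y basis_subset by (auto simp: pm_def)
  moreover have "y \<in> pm G (X \<inter> ?X)" if "inv y \<in> X \<inter> ?X"
    using that yc unfolding pm_def by (intro UnI2 image_eqI[of _ _ "inv y"]) auto
  ultimately have yX: "y \<in> pm G (X \<inter> ?X)" by (auto simp: pm_def)
  have y'X: "inv y \<in> pm G (X \<inter> ?X)"
    using inv_pm[OF _ yX] basis_subset by blast
  define z where "z = (if l = 0 then y else inv y)"
  have "?X \<subseteq> ({\<one>, inv z} <#> X) <#> {\<one>, z}"
  proof
    fix x' assume "x' \<in> ?X"
    then obtain x where x: "x \<in> X" "x' = whitehead_map G y \<chi> x" by blast
    have "x \<in> pm G X" "inv x \<in> pm G X" using x by (auto simp: pm_def)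
    then have "\<chi> x = l \<or> \<chi> x = l + 1" "\<chi> (inv x) = l \<or> \<chi> (inv x) = l + 1" using \<chi> by auto
    then have "y [^] (- \<chi> x) \<in> {\<one>, inv z}" "y [^] \<chi> (inv x) \<in> {\<one>, z}"
      using l yc by (auto simp: z_def int_pow_neg)
    then show "x' \<in> ({\<one>, inv z} <#> X) <#> {\<one>, z}"
      using x unfolding whitehead_map_def set_mult_def by blast
  qed
  moreover have "z \<in> pm G (X \<inter> ?X)" using yX y'X by (simp add: z_def)
  moreover have "basis G ?X" using y fix_y by (rule basis_whitehead_map)
  ultimately show ?thesis using basis unfolding whitehead_neighbour_def by blast
qed

lemma whitehead_map_letter:
  assumes "y \<in> carrier G" "a \<in> pm G X"
  shows "whitehead_map G y \<chi> a \<in> pm G (whitehead_map G y \<chi> ` X)"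
  using assms basis_subset by (auto simp: pm_def whitehead_map_inv subset_iff)

text \<open>The key computation. Write \<open>w = x\<^sub>1 \<dots> x\<^sub>n\<close> and insert \<open>y\<^bsup>e\<^esup> y\<^bsup>-e\<^esup>\<close> at each turn, where
  \<open>e\<close> is the larger of the two values that \<open>\<chi>\<close> takes on the turn. It is attained at every end of
  the turn other than \<open>y\<close>, so a letter \<open>x \<noteq> y\<^sup>\<plusminus>\<^sup>1\<close> turns into its Whitehead image. A letter \<open>y\<close> or \<open>y\<^sup>-\<^sup>1\<close> is
  kept, but at a turn that joins \<open>y\<close> to the upper side the exponents differ by one and the
  letter disappears. Such a letter is \<open>y\<close> when the turn is on its left and \<open>y\<^sup>-\<^sup>1\<close> when the turn
  is on its right, so each is deleted on behalf of one turn only.\<close>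

lemma whitehead_map_word:
  fixes \<chi> :: "'a \<Rightarrow> int"
  assumes r: "r \<in> nontrivial_items G" and w: "is_spelling G X r w" and y: "y \<in> pm G X"
    and \<chi>: "\<chi> y = l" "\<chi> (inv y) = l" "\<chi> \<one> = 0" "\<And>a. a \<in> zpm G X \<Longrightarrow> \<chi> a = l \<or> \<chi> a = l + 1"
    and turn: "\<And>i. i \<le> length w \<Longrightarrow>
      (inv (bordered G r w ! i) \<noteq> y \<longrightarrow>
        \<chi> (bordered G r w ! Suc i) \<le> \<chi> (inv (bordered G r w ! i))) \<and>
      (bordered G r w ! Suc i \<noteq> y \<longrightarrow>
        \<chi> (inv (bordered G r w ! i)) \<le> \<chi> (bordered G r w ! Suc i))"
  shows "\<exists>v. set v \<subseteq> pm G (whitehead_map G y \<chi> ` X) \<and> represents G v r \<and>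
    length v \<le> length w \<and>
    ((\<exists>i \<le> length w.
        inv (bordered G r w ! i) = y \<and> \<chi> (bordered G r w ! Suc i) = l + 1 \<or>
        bordered G r w ! Suc i = y \<and> \<chi> (inv (bordered G r w ! i)) = l + 1)
      \<longrightarrow> length v < length w)"
proof -
  let ?b = "bordered G r w" and ?n = "length w" and ?T = "whitehead_map G y \<chi>"
  define e where "e i = max (\<chi> (inv (?b ! i))) (\<chi> (?b ! Suc i))" for i
  define piece where "piece j = y [^] (- e j) \<otimes> w ! j \<otimes> y [^] e (Suc j)" for j
  define v where "v = filter (\<lambda>a. a \<noteq> \<one>) (map piece [0..<?n])"
  have yc: "y \<in> carrier G" "inv y \<noteq> y" using y letter_closed inv_letter_neq by auto
  have y1: "y \<noteq> \<one>" "inv y \<noteq> \<one>" using y letter_neq_one inv_letter by auto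
  have wX: "set w \<subseteq> pm G X" and wne: "w \<noteq> []"
    using w spelling_nonempty[OF r w] by (auto simp: is_spelling_def)
  have wc: "set w \<subseteq> carrier G" using word_closed[OF wX] .
  have zb: "?b ! i \<in> zpm G X" if "i \<le> Suc ?n" for i using bordered_zpm[OF r w that] .
  have cb: "?b ! i \<in> carrier G" if "i \<le> Suc ?n" for i using zb[OF that] zpm_closed by blast
  have e_range: "e i = l \<or> e i = l + 1" if "i \<le> ?n" for i
    using \<chi>(4)[OF inv_zpm[OF zb[of i]]] \<chi>(4)[OF zb[of "Suc i"]] that by (auto simp: e_def)
  have e_left: "e i = \<chi> (inv (?b ! i))" if "i \<le> ?n" "inv (?b ! i) \<noteq> y" for i
    using turn[OF that(1)] that(2) by (auto simp: e_def)
  have e_right: "e i = \<chi> (?b ! Suc i)" if "i \<le> ?n" "?b ! Suc i \<noteq> y" for i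
    using turn[OF that(1)] that(2) by (auto simp: e_def)
  have e_ends: "r = Elt g \<Longrightarrow> e 0 = 0 \<and> e ?n = 0" for g
    using e_left[of 0] e_right[of ?n] y1 \<chi>(3) by (auto simp: nth_append)
  have e_cyc: "e 0 = e ?n"
    using bordered_ends[OF wne, of r] e_left[of 0] e_right[of ?n] y1(1) \<chi>(3)
    by (auto simp: e_def)
  have e_pos: "e (Suc j) = l" if "j < ?n" "w ! j = y" for j
    using e_left[of "Suc j"] that bordered_nth[of j w G r] yc \<chi>(2) by simp
  have e_neg: "e j = l" if "j < ?n" "w ! j = inv y" for j
    using e_right[of j] that bordered_nth[of j w G r] yc \<chi>(2) by simp
  have pow_l: "y [^] (- (l + 1)) \<otimes> y \<otimes> y [^] l = \<one>" "y [^] (- l) \<otimes> inv y \<otimes> y [^] (l + 1) = \<one>"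
  proof -
    have "y [^] (- (l + 1)) \<otimes> y [^] (1 :: int) \<otimes> y [^] l = y [^] (0 :: int)"
      "y [^] (- l) \<otimes> y [^] (- 1 :: int) \<otimes> y [^] (l + 1) = y [^] (0 :: int)"
      using yc(1) by (simp_all only: int_pow_mult[symmetric]) simp_all
    then show "y [^] (- (l + 1)) \<otimes> y \<otimes> y [^] l = \<one>" "y [^] (- l) \<otimes> inv y \<otimes> y [^] (l + 1) = \<one>"
      using int_pow_neg[OF yc(1), of 1] int_pow_1[OF yc(1)] by simp_all
  qed
  have fix_y: "?T y = y" "?T (inv y) = inv y" using whitehead_map_fixes yc \<chi> by auto
  have del_pos: "piece j = \<one>" if "j < ?n" "w ! j = y" "e j = l + 1" for j
    using that e_pos[of j] pow_l by (simp add: piece_def)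
  have del_neg: "piece j = \<one>" if "j < ?n" "w ! j = inv y" "e (Suc j) = l + 1" for j
    using that e_neg[of j] pow_l by (simp add: piece_def)
  have piece: "piece j = \<one> \<or> piece j = ?T (w ! j)" if j: "j < ?n" for j
  proof -
    have b: "?b ! Suc j = w ! j" using j by (rule bordered_nth)
    have c: "w ! j \<in> carrier G" using wc j by (auto simp: subset_iff)
    consider "w ! j = y" | "w ! j = inv y" | "w ! j \<noteq> y" "inv (w ! j) \<noteq> y"
      using c inv_inv by metis
    then show ?thesis
    proof cases
      case 1
      then show ?thesis
        using e_range[of j] j del_pos[OF j 1] e_pos[OF j 1] int_pow_conj_self(1)[OF yc(1), of l] fix_y
        by (auto simp: piece_def)
    next
      case 2
      then show ?thesis
        using e_range[of "Suc j"] j del_neg[OF j 2] e_neg[OF j 2]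
          int_pow_conj_self(2)[OF yc(1), of l] fix_y
        by (auto simp: piece_def)
    next
      case 3
      then show ?thesis
        using e_right[of j] e_left[of "Suc j"] j b by (simp add: piece_def whitehead_map_def)
    qed
  qed
  have "set v \<subseteq> pm G (?T ` X)"
  proof
    fix a assume "a \<in> set v"
    then obtain j where "j < ?n" "a = piece j" "a \<noteq> \<one>" by (auto simp: v_def)
    then have "a = ?T (w ! j)" "w ! j \<in> pm G X" using piece[of j] wX by (auto simp: subset_iff)
    then show "a \<in> pm G (?T ` X)" using whitehead_map_letter yc by simp
  qed
  moreover have "represents G v r"
  proof -
    have "set (map piece [0..<?n]) \<subseteq> carrier G"
      using yc(1) wc by (auto simp: piece_def subset_iff)
    then have v: "list_prod G v = y [^] (- e 0) \<otimes> list_prod G w \<otimes> y [^] e ?n"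
      using list_prod_telescope[OF yc(1) wc, of e]
      by (simp add: v_def list_prod_drop_ones piece_def[abs_def])
    from r show ?thesis
    proof (cases rule: nontrivial_itemE)
      case (Elt g)
      then have "list_prod G w = g" using w by (simp add: is_spelling_def)
      then show ?thesis using v e_ends[OF Elt(1)] Elt by simp
    next
      case (Cls g)
      then have "list_prod G w \<in> conj_class G g" using w by (simp add: is_spelling_def)
      then have "y [^] (- e 0) \<otimes> list_prod G w \<otimes> inv (y [^] (- e 0)) \<in> conj_class G g"
        using Cls yc by (intro conj_class_conj) auto
      moreover have "inv (y [^] (- e 0)) = y [^] e ?n"
        using yc(1) e_cyc by (simp add: int_pow_neg)
      ultimately show ?thesis using v Cls by simp
    qed
  qed
  moreover have "length v \<le> ?n"
    using length_filter_le[of "\<lambda>a. a \<noteq> \<one>" "map piece [0..<?n]"] by (simp add: v_def)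
  moreover have "length v < ?n"
    if "i \<le> ?n" "inv (?b ! i) = y \<and> \<chi> (?b ! Suc i) = l + 1 \<or>
      ?b ! Suc i = y \<and> \<chi> (inv (?b ! i)) = l + 1" for i
  proof -
    have ei: "e i = l + 1" using that \<chi>(1) by (auto simp: e_def)
    have ci: "?b ! i \<in> carrier G" using cb that(1) by simp
    have "\<exists>j < ?n. piece j = \<one>"
    proof (cases "?b ! Suc i = y")
      case True
      show ?thesis
      proof (cases "i < ?n")
        case True
        then show ?thesis using del_pos[of i] ei \<open>?b ! Suc i = y\<close> bordered_nth[of i w G r] by auto
      next
        \<comment> \<open>The last turn of a class is also its first one.\<close>
        case False
        then have "i = ?n" using that(1) by simp
        then have "?b ! Suc 0 = y" using bordered_ends[OF wne, of r] True y1 by auto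
        then show ?thesis
          using del_pos[of 0] ei e_cyc \<open>i = ?n\<close> bordered_nth[of 0 w G r] wne by auto
      qed
    next
      case False
      then have bi: "?b ! i = inv y" using that(2) ci by auto
      show ?thesis
      proof (cases i)
        case 0
        then have "?b ! ?n = inv y" using bordered_ends[OF wne, of r] bi y1 by auto
        moreover obtain m where m: "?n = Suc m" using wne by (cases w) auto
        ultimately have "w ! m = inv y" using bordered_nth[of m w G r] by simp
        then show ?thesis using del_neg[of m] ei e_cyc 0 m by auto
      next
        case (Suc j)
        then show ?thesis using del_neg[of j] ei bi that(1) Suc bordered_nth[of j w G r] by (auto simp: Suc_le_eq)
      qed
    qed
    then obtain j where "j < ?n" "piece j = \<one>" by blast
    then have "\<one> \<in> set (map piece [0..<?n])" by force
    then show ?thesis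
      using length_filter_less[of \<one> "map piece [0..<?n]" "\<lambda>a. a \<noteq> \<one>"] by (simp add: v_def)
  qed
  ultimately show ?thesis by blast
qed

lemma turns_edge_vertices:
  assumes "S \<subseteq> nontrivial_items G" "r \<in> S" "i \<le> length (spelling G X r)"
  defines "b \<equiv> bordered G r (spelling G X r)"
  shows "(inv (b ! i), b ! Suc i) \<in> snd (whitehead_graph G X S)"
    and "inv (b ! i) \<in> fst (whitehead_graph G X S)"
    and "b ! Suc i \<in> fst (whitehead_graph G X S)"
    and "inv (b ! i) \<noteq> b ! Suc i"
proof -
  have r: "r \<in> nontrivial_items G" using assms by blast
  note sp = is_spelling_spelling[OF r]
  have edge: "(inv (b ! i), b ! Suc i) \<in> turns G X r"
    unfolding turns_def Let_def b_def using assms(3) by blast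
  then show "(inv (b ! i), b ! Suc i) \<in> snd (whitehead_graph G X S)"
    using assms(2) by (auto simp: whitehead_graph_def)
  have "inv (b ! i) \<in> zpm G X" "b ! Suc i \<in> zpm G X"
    using bordered_zpm[OF r sp] inv_zpm assms(3) by (simp_all add: b_def)
  then show "inv (b ! i) \<in> fst (whitehead_graph G X S)" "b ! Suc i \<in> fst (whitehead_graph G X S)"
    using edge assms(2) by (auto simp: whitehead_graph_def meets_def intro!: bexI[OF _ assms(2)] bexI[OF _ edge])
  show "inv (b ! i) \<noteq> b ! Suc i"
    using sp assms(3) by (auto simp: is_spelling_def b_def)
qed

lemma edgeE:
  assumes "e \<in> snd (whitehead_graph G X S)"
  obtains r i where "r \<in> S" "i \<le> length (spelling G X r)"
    "e = (inv (bordered G r (spelling G X r) ! i), bordered G r (spelling G X r) ! Suc i)"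
  using assms by (auto simp: whitehead_graph_def turns_def Let_def)

text \<open>An edge joins two vertices with equal \<open>\<chi>\<close> unless it joins \<open>y\<close> to the upper side \<open>Y\<^sub>+\<close>.
  Hence no item gets longer, and the required edge between \<open>y\<close> and \<open>Y\<^sub>+\<close> shortens an item that it
  comes from.\<close>

lemma subroutine_output_decreases:
  assumes S: "finite S" "S \<subseteq> nontrivial_items G" and out: "subroutine_output G X S X'"
  obtains y \<chi> l where "X' = whitehead_map G y \<chi> ` X" "y \<in> pm G X" "\<chi> (inv y) = \<chi> y"
    "l = 0 \<or> l = - 1" "\<forall>a \<in> pm G X. \<chi> a = l \<or> \<chi> a = l + 1"
    "total_length G X' S < total_length G X S"
proof -
  let ?V = "fst (whitehead_graph G X S)" and ?E = "snd (whitehead_graph G X S)"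
  obtain y Ym Yp and \<chi> :: "'a \<Rightarrow> int" where y: "y \<in> pm G X" and
    dj: "Ym \<inter> Yp = {}" and V: "Ym \<union> Yp = ?V - {y}" and iy: "inv y \<in> Ym" and
    sep: "\<not> (\<exists>e \<in> ?E. meets e Ym \<and> meets e Yp)" and join: "\<exists>e \<in> ?E. meets e Yp \<and> meets e {y}" and
    \<chi>: "let l = (if \<one> \<in> Yp then -1 else 0) in
          \<chi> ` zpm G X \<subseteq> {l, l + 1} \<and> \<chi> \<one> = 0 \<and> (\<forall>x \<in> Ym \<union> {y}. \<chi> x = l) \<and> (\<forall>x \<in> Yp. \<chi> x = l + 1)" and
    X': "X' = {y [^] (- \<chi> x) \<otimes> x \<otimes> y [^] \<chi> (inv x) | x. x \<in> X}"
    using out unfolding subroutine_output_def Let_def by blast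
  define l :: int where "l = (if \<one> \<in> Yp then -1 else 0)"
  have \<chi>1: "\<chi> ` zpm G X \<subseteq> {l, l + 1}" "\<chi> \<one> = 0" "\<And>x. x \<in> Ym \<Longrightarrow> \<chi> x = l" "\<chi> y = l"
    "\<And>x. x \<in> Yp \<Longrightarrow> \<chi> x = l + 1"
    using \<chi> unfolding Let_def l_def[symmetric] by auto
  have l: "l = 0 \<or> l = - 1" by (simp add: l_def)
  have \<chi>z: "\<And>a. a \<in> zpm G X \<Longrightarrow> \<chi> a = l \<or> \<chi> a = l + 1" using \<chi>1(1) by blast
  have X'T: "X' = whitehead_map G y \<chi> ` X" unfolding X' whitehead_map_def by blast
  have iyl: "\<chi> (inv y) = l" using \<chi>1 iy by blast
  then have b': "basis G X'" unfolding X'T using y \<chi>1(4) by (intro basis_whitehead_map) auto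
  interpret B': free_basis G X' by unfold_locales (rule b')
  have word: "\<exists>v. set v \<subseteq> pm G X' \<and> represents G v r \<and> length v \<le> item_length G X r \<and>
      ((\<exists>e \<in> turns G X r. meets e Yp \<and> meets e {y}) \<longrightarrow> length v < item_length G X r)"
    if r: "r \<in> S" for r
  proof -
    have rn: "r \<in> nontrivial_items G" using r S by blast
    let ?w = "spelling G X r"
    let ?b = "bordered G r ?w"
    have sides: "inv (?b ! i) \<in> Ym \<union> Yp \<union> {y}" "?b ! Suc i \<in> Ym \<union> Yp \<union> {y}"
      "\<not> (inv (?b ! i) \<in> Ym \<and> ?b ! Suc i \<in> Yp)" "\<not> (inv (?b ! i) \<in> Yp \<and> ?b ! Suc i \<in> Ym)"
      if "i \<le> length ?w" for i
      using turns_edge_vertices[OF S(2) r that] V sep by (auto simp: meets_def)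
    have "\<exists>v. set v \<subseteq> pm G (whitehead_map G y \<chi> ` X) \<and> represents G v r \<and> length v \<le> length ?w \<and>
      ((\<exists>i \<le> length ?w. inv (?b ! i) = y \<and> \<chi> (?b ! Suc i) = l + 1 \<or>
          ?b ! Suc i = y \<and> \<chi> (inv (?b ! i)) = l + 1) \<longrightarrow> length v < length ?w)"
    proof (rule whitehead_map_word[OF rn is_spelling_spelling[OF rn] y \<chi>1(4) iyl \<chi>1(2) \<chi>z])
      fix i assume "i \<le> length ?w"
      from sides[OF this] show "(inv (?b ! i) \<noteq> y \<longrightarrow> \<chi> (?b ! Suc i) \<le> \<chi> (inv (?b ! i))) \<and>
        (?b ! Suc i \<noteq> y \<longrightarrow> \<chi> (inv (?b ! i)) \<le> \<chi> (?b ! Suc i))"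
        using \<chi>1(3-5) by force
    qed
    moreover have "\<exists>i \<le> length ?w. inv (?b ! i) = y \<and> \<chi> (?b ! Suc i) = l + 1 \<or>
          ?b ! Suc i = y \<and> \<chi> (inv (?b ! i)) = l + 1"
      if ex: "\<exists>e \<in> turns G X r. meets e Yp \<and> meets e {y}"
    proof -
      obtain i where i: "i \<le> length ?w" "meets (inv (?b ! i), ?b ! Suc i) Yp"
        "meets (inv (?b ! i), ?b ! Suc i) {y}"
        using ex by (auto simp: turns_def Let_def)
      moreover have "y \<notin> Yp" using V by blast
      ultimately show ?thesis using \<chi>1(5) unfolding meets_def by fastforce
    qed
    ultimately show ?thesis unfolding X'T item_length_def by blast
  qed
  have le: "item_length G X' r \<le> item_length G X r" if "r \<in> S" for r
    using word[OF that] B'.item_length_le S(2) that by (meson order_trans subsetD)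
  obtain r where r: "r \<in> S" "\<exists>e \<in> turns G X r. meets e Yp \<and> meets e {y}"
    using join by (auto simp: whitehead_graph_def)
  then have lt: "item_length G X' r < item_length G X r"
    using word[OF r(1)] B'.item_length_le S(2) by (meson order_le_less_trans subsetD)
  have "total_length G X' S < total_length G X S"
    unfolding total_length_def
    by (rule sum_strict_mono_ex1) (use S(1) le r(1) lt in blast)+
  moreover have "\<chi> (inv y) = \<chi> y" using iyl \<chi>1(4) by simp
  moreover have "\<forall>a \<in> pm G X. \<chi> a = l \<or> \<chi> a = l + 1"
    using \<chi>z by (simp add: zpm_def)
  ultimately show thesis by (intro that[OF X'T y _ l])
qed

lemma subroutine_output_exists:
  assumes y: "y \<in> pm G X" and Y: "Ym \<inter> Yp = {}" "Ym \<union> Yp = fst (whitehead_graph G X S) - {y}"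
    "inv y \<in> Ym" "\<not> (\<exists>e \<in> snd (whitehead_graph G X S). meets e Ym \<and> meets e Yp)"
    "\<exists>e \<in> snd (whitehead_graph G X S). meets e Yp \<and> meets e {y}"
  shows "\<exists>X'. subroutine_output G X S X'"
proof -
  define l :: int where "l = (if \<one> \<in> Yp then -1 else 0)"
  define \<chi> where "\<chi> x = (if x = \<one> then 0 else if x \<in> Yp then l + 1 else l)" for x
  have "y \<noteq> \<one>" using y letter_neq_one by blast
  moreover have "y \<notin> Yp" using Y(2) by blast
  ultimately have \<chi>: "\<chi> ` zpm G X \<subseteq> {l, l + 1}" "\<chi> \<one> = 0" "\<forall>x \<in> Ym \<union> {y}. \<chi> x = l" "\<forall>x \<in> Yp. \<chi> x = l + 1"
    using Y(1) by (auto simp: \<chi>_def l_def)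
  show ?thesis
    unfolding subroutine_output_def Let_def
    by (rule exI, rule exI[of _ y], rule exI[of _ Ym], rule exI[of _ Yp], rule exI[of _ \<chi>])
      (use y Y \<chi> in \<open>simp add: l_def\<close>)
qed

lemma bordered_vertices:
  assumes S: "S \<subseteq> nontrivial_items G" "r \<in> S" and i: "i \<le> Suc (length (spelling G X r))"
  defines "b \<equiv> bordered G r (spelling G X r)"
  shows "b ! i \<in> fst (whitehead_graph G X S) \<and> inv (b ! i) \<in> fst (whitehead_graph G X S)"
proof -
  let ?w = "spelling G X r" and ?V = "fst (whitehead_graph G X S)"
  have r: "r \<in> nontrivial_items G" using S by blast
  have ne: "?w \<noteq> []" using spelling_nonempty[OF r is_spelling_spelling[OF r]] .
  then obtain m where m: "length ?w = Suc m" by (cases ?w) auto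
  have right: "b ! Suc j \<in> ?V" and left: "inv (b ! j) \<in> ?V" if "j \<le> length ?w" for j
    using turns_edge_vertices[OF S that] by (simp_all add: b_def)
  consider "i = 0" | "0 < i" "i \<le> length ?w" | "i = Suc (length ?w)" using i by linarith
  then show ?thesis
  proof cases
    case 1
    then show ?thesis
      using left[of 0] right[of m] bordered_ends[OF ne, of r] m by (auto simp: b_def)
  next
    case 2
    then obtain j where "i = Suc j" "j \<le> length ?w" by (cases i) auto
    then show ?thesis using right[of j] left[of i] 2 by simp
  next
    case 3
    then show ?thesis
      using right[of "length ?w"] left[of 1] bordered_ends[OF ne, of r] m by (auto simp: b_def)
  qed
qed

text \<open>Each letter of a word lies between two turns; one contributes the letter itself as a vertex,
  the other its inverse.\<close>

lemma vertex_inv: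
  assumes "S \<subseteq> nontrivial_items G" "v \<in> fst (whitehead_graph G X S)"
  shows "inv v \<in> fst (whitehead_graph G X S)"
proof -
  obtain e where e: "e \<in> snd (whitehead_graph G X S)" "meets e {v}"
    using assms(2) by (auto simp: whitehead_graph_def)
  then obtain r i where r: "r \<in> S" and i: "i \<le> length (spelling G X r)" and
    "e = (inv (bordered G r (spelling G X r) ! i), bordered G r (spelling G X r) ! Suc i)"
    using edgeE by metis
  moreover have "bordered G r (spelling G X r) ! i \<in> carrier G"
    using r i assms(1) zpm_closed bordered_zpm is_spelling_spelling by (meson le_SucI subsetD)
  ultimately have "inv v = bordered G r (spelling G X r) ! i \<or>
      inv v = inv (bordered G r (spelling G X r) ! Suc i)"
    using e(2) by (auto simp: meets_def)
  then show ?thesis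
    using bordered_vertices[OF assms(1) r, of i] bordered_vertices[OF assms(1) r, of "Suc i"] i by auto
qed

text \<open>Let \<open>V\<^sub>2\<close> be the side of the cutvertex \<open>v\<close> without \<open>v\<^sup>-\<^sup>1\<close>. If \<open>v\<close> has a neighbour in \<open>V\<^sub>2\<close>,
  the subroutine can choose \<open>v\<close>. Otherwise \<open>V\<^sub>2\<close> is a union of components, and any
  letter \<open>x \<in> V\<^sub>2\<close> with \<open>x\<^sup>-\<^sup>1 \<notin> V\<^sub>2\<close> can be chosen in place of \<open>v\<close>. If there is no such letter,
  then \<open>V\<^sub>2\<close> is closed under inverses; following a word from turn to turn, either all of its
  letters lie in \<open>V\<^sub>2\<close> or none does. So the supports respect a proper partition of \<open>X\<close>.\<close>

lemma subroutine_applicable: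
  assumes S: "S \<subseteq> nontrivial_items G" and fin: "finest_partition G X S = {X}"
    and cut: "has_basis_cutvertex G X S"
  shows "\<exists>X'. subroutine_output G X S X'"
proof -
  let ?V = "fst (whitehead_graph G X S)" and ?E = "snd (whitehead_graph G X S)"
  obtain v V1 V2 where v: "v \<in> pm G X" "v \<in> ?V" and V: "?V - {v} = V1 \<union> V2" "V1 \<inter> V2 = {}"
    and ne: "V1 \<noteq> {}" "V2 \<noteq> {}" and sep: "\<not> (\<exists>e \<in> ?E. meets e V1 \<and> meets e V2)"
    and iv: "inv v \<in> V1"
  proof -
    obtain v V1 V2 where *: "v \<in> pm G X" "v \<in> ?V" "?V - {v} = V1 \<union> V2" "V1 \<inter> V2 = {}"
      "V1 \<noteq> {}" "V2 \<noteq> {}" "\<not> (\<exists>e \<in> ?E. meets e V1 \<and> meets e V2)"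
      using cut unfolding has_basis_cutvertex_def cutvertex_def by blast
    have "inv v \<in> V1 \<or> inv v \<in> V2"
      using vertex_inv[OF S *(2)] inv_letter_neq[OF *(1)] *(3) by blast
    then show thesis
    proof
      assume "inv v \<in> V1"
      then show thesis using that[of v V1 V2] * by blast
    next
      assume "inv v \<in> V2"
      then show thesis using that[of v V2 V1] * by (simp add: Int_commute Un_commute conj_commute)
    qed
  qed
  have ends: "fst e \<in> ?V" "snd e \<in> ?V" "fst e \<noteq> snd e" if "e \<in> ?E" for e
    using that turns_edge_vertices[OF S] by (auto elim!: edgeE)
  show ?thesis
  proof (cases "\<exists>e \<in> ?E. meets e V2 \<and> meets e {v}")
    case True
    then show ?thesis using subroutine_output_exists[of v V1 V2] v V sep iv by auto
  next
    case False
    have closed: "fst e \<in> V2 \<longleftrightarrow> snd e \<in> V2" if "e \<in> ?E" for e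
      using ends[OF that] that False sep V unfolding meets_def by blast
    show ?thesis
    proof (cases "\<exists>x \<in> V2. x \<noteq> \<one> \<and> inv x \<notin> V2")
      case True
      then obtain x where x: "x \<in> V2" "x \<noteq> \<one>" "inv x \<notin> V2" by blast
      have xV: "x \<in> ?V" using x V by blast
      then have xp: "x \<in> pm G X" using x(2) by (auto simp: whitehead_graph_def zpm_def)
      obtain e where e: "e \<in> ?E" "meets e {x}" using xV by (auto simp: whitehead_graph_def)
      have "meets e (V2 - {x})"
        using closed[OF e(1)] ends(3)[OF e(1)] e(2) x(1) unfolding meets_def by auto
      moreover have "\<not> (\<exists>e \<in> ?E. meets e (?V - V2) \<and> meets e (V2 - {x}))"
        using closed by (auto simp: meets_def)
      moreover have "V2 \<subseteq> ?V" using V by blast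
      ultimately show ?thesis
        using subroutine_output_exists[of x "?V - V2" "V2 - {x}"] xp x vertex_inv[OF S xV] e
        by blast
    next
      case False
      have inv_V2: "inv a \<in> V2 \<longleftrightarrow> a \<in> V2" if "a \<in> carrier G" for a
        using False that by (metis inv_inv inv_one)
      have side: "support G X r \<subseteq> X \<inter> V2 \<or> support G X r \<subseteq> X - V2" if r: "r \<in> S" for r
      proof -
        have rn: "r \<in> nontrivial_items G" using r S by blast
        let ?w = "spelling G X r"
        let ?b = "bordered G r ?w"
        have "?b ! i \<in> V2 \<longleftrightarrow> ?b ! 0 \<in> V2" if "i \<le> Suc (length ?w)" for i
          using that
        proof (induction i)
          case (Suc i)
          have "?b ! i \<in> carrier G"
            using bordered_zpm[OF rn is_spelling_spelling[OF rn]] zpm_closed Suc.prems by simp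
          then have "?b ! i \<in> V2 \<longleftrightarrow> ?b ! Suc i \<in> V2"
            using closed[OF turns_edge_vertices(1)[OF S r, of i]] inv_V2 Suc.prems by simp
          then show ?case using Suc by simp
        qed simp
        then have "?w ! i \<in> V2 \<longleftrightarrow> ?b ! 0 \<in> V2" if "i < length ?w" for i
          using bordered_nth[OF that, of G r] that by (metis Suc_leI le_SucI)
        then have "a \<in> V2 \<longleftrightarrow> ?b ! 0 \<in> V2" if "a \<in> set ?w" for a
          using that by (metis in_set_conv_nth)
        moreover have "set ?w \<subseteq> carrier G" using word_closed[OF spelling_letters[OF rn]] .
        ultimately have "a \<in> V2 \<longleftrightarrow> ?b ! 0 \<in> V2" if "a \<in> pm G (set ?w)" for a
          using that inv_V2 by (auto simp: pm_def subset_iff)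
        then show ?thesis unfolding support_def by blast
      qed
      have letter_side: "\<exists>x \<in> X. (x \<in> V2) = (a \<in> V2)" if "a \<in> pm G X" for a
        using that inv_V2 basis_subset by (auto simp: pm_def)
      have "\<exists>a \<in> pm G X. a \<in> V2"
      proof -
        obtain d where d: "d \<in> V2" using ne by blast
        then have "d \<in> ?V" using V by blast
        then obtain e where e: "e \<in> ?E" "meets e {d}" by (auto simp: whitehead_graph_def)
        have "fst e \<in> V2" "snd e \<in> V2" "fst e \<noteq> snd e"
          using closed[OF e(1)] ends(3)[OF e(1)] e(2) d unfolding meets_def by auto
        moreover have "V2 \<subseteq> zpm G X" using V by (auto simp: whitehead_graph_def)
        ultimately show ?thesis unfolding zpm_def by (metis insertE subsetD)
      qed
      then have in2: "X \<inter> V2 \<noteq> {}" using letter_side by blast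
      have "v \<notin> V2" using V by blast
      then have out2: "X - V2 \<noteq> {}" using letter_side[OF v(1)] by blast
      have "partition_on X {X \<inter> V2, X - V2}"
        using in2 out2 by (auto simp: partition_on_def disjoint_def)
      then have "admissible_partition G X S {X \<inter> V2, X - V2}"
        using side by (auto simp: admissible_partition_def)
      then have "refines X {X} {X \<inter> V2, X - V2}"
        using finest_partition_props(2)[of S G X] support_nonempty S fin by (metis subsetD)
      then have "X \<subseteq> X \<inter> V2 \<or> X \<subseteq> X - V2" by (auto simp: refines_def)
      then show ?thesis using in2 out2 by blast
    qed
  qed
qed

end

section \<open>Free factors\<close>

lemma list_prod_subgroup_generated [simp]: "list_prod (subgroup_generated G Y) = list_prod G"
  by (simp add: list_prod_def[abs_def])

context group
begin

lemma conj_class_subgroup_generated: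
  assumes "h \<in> carrier (subgroup_generated G Y)"
  shows "conj_class (subgroup_generated G Y) h \<subseteq> conj_class G h \<inter> carrier (subgroup_generated G Y)"
proof -
  interpret H: group "subgroup_generated G Y" by simp
  show ?thesis
  proof
    fix k assume k: "k \<in> conj_class (subgroup_generated G Y) h"
    then obtain f where "f \<in> carrier (subgroup_generated G Y)" "k = f \<otimes> h \<otimes> inv f"
      by (auto simp: conj_class_def)
    moreover from this have "f \<in> carrier G" using carrier_subgroup_generated_subset by blast
    ultimately show "k \<in> conj_class G h \<inter> carrier (subgroup_generated G Y)"
      using k H.conj_class_subset[OF assms] by (auto simp: conj_class_def)
  qed
qed

lemma pm_subgroup_generated:
  assumes "Z \<subseteq> carrier (subgroup_generated G Y)"
  shows "pm (subgroup_generated G Y) Z = pm G Z"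
  using assms by (auto simp: pm_def subset_iff image_iff)

lemma generate_subgroup_generated:
  assumes "Z \<subseteq> carrier (subgroup_generated G Y)"
  shows "generate (subgroup_generated G Y) Z = generate G Z"
  using generate_consistent[OF assms subgroup_subgroup_generated]
  by (simp add: subgroup_generated_def)

lemma whitehead_map_subgroup_generated:
  assumes "y \<in> carrier (subgroup_generated G Y)" "x \<in> carrier (subgroup_generated G Y)"
  shows "whitehead_map (subgroup_generated G Y) y \<chi> x = whitehead_map G y \<chi> x"
  using assms by (simp add: whitehead_map_def int_pow_subgroup_generated)

lemma free_reduced_subgroup_generated:
  assumes "set w \<subseteq> carrier (subgroup_generated G Y)"
  shows "free_reduced (subgroup_generated G Y) w = free_reduced G w"
  unfolding free_reduced_def by (rule successively_cong) (use assms in auto)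

lemma cyc_reduced_subgroup_generated:
  assumes "set w \<subseteq> carrier (subgroup_generated G Y)"
  shows "cyc_reduced (subgroup_generated G Y) w = cyc_reduced G w"
proof (cases "w = []")
  case False
  then have "last w \<in> carrier (subgroup_generated G Y)" using assms last_in_set by blast
  then show ?thesis using free_reduced_subgroup_generated[OF assms] by (simp add: cyc_reduced_def)
qed (simp add: cyc_reduced_def)

end

context free_basis
begin

lemma basis_subgroup_generated:
  assumes "Y \<subseteq> X"
  shows "basis (subgroup_generated G Y) Y"
proof -
  let ?H = "subgroup_generated G Y"
  have YG: "Y \<subseteq> carrier G" using assms basis_subset by blast
  have YH: "Y \<subseteq> carrier ?H" using subgroup_generated_subset_carrier_subset[OF YG] .
  have "carrier G \<inter> Y = Y" using YG by blast
  then have "generate ?H Y = carrier ?H"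
    using generate_subgroup_generated[OF YH] by (simp add: carrier_subgroup_generated)
  moreover have "list_prod ?H (map (letter_val ?H) w) \<noteq> \<one>\<^bsub>?H\<^esub>"
    if w: "fst ` set w \<subseteq> Y" "reduced_word w" "w \<noteq> []" for w
  proof -
    have "fst a \<in> carrier ?H" if "a \<in> set w" for a using that w(1) YH by auto
    then have m: "map (letter_val ?H) w = map (letter_val G) w" by (simp add: letter_val_def)
    have "fst ` set w \<subseteq> X" using w(1) assms by blast
    then show ?thesis unfolding m using no_formal_relation[of w] w by simp
  qed
  ultimately show ?thesis using YH by (simp add: basis_def)
qed

text \<open>Since spellings over \<open>X\<close> are unique up to rotation, this one direction is enough to compare
  lengths and supports over \<open>X\<close> with those over \<open>Y\<close>.\<close>

lemma is_spelling_free_factor: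
  assumes Y: "Y \<subseteq> X" and r: "r \<in> nontrivial_items G"
    and r': "item_in (carrier (subgroup_generated G Y)) r \<in> nontrivial_items (subgroup_generated G Y)"
    and w: "is_spelling (subgroup_generated G Y) Y (item_in (carrier (subgroup_generated G Y)) r) w"
  shows "is_spelling G X r w"
proof -
  let ?H = "subgroup_generated G Y"
  interpret H: group ?H by simp
  interpret H: free_basis ?H Y by unfold_locales (rule basis_subgroup_generated[OF Y])
  have pmY: "pm ?H Y = pm G Y" using H.basis_subset by (rule pm_subgroup_generated)
  have wY: "set w \<subseteq> pm G Y" using w pmY by (auto simp: is_spelling_def)
  then have wH: "set w \<subseteq> carrier ?H" using H.word_closed pmY by simp
  have wX: "set w \<subseteq> pm G X" using wY pm_mono[OF Y] by blast
  from r show ?thesis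
  proof (cases rule: nontrivial_itemE)
    case (Elt g)
    then show ?thesis
      using w wX free_reduced_subgroup_generated[OF wH] by (simp add: is_spelling_Elt H.is_spelling_Elt)
  next
    case (Cls g)
    then show ?thesis
      using w wX cyc_reduced_subgroup_generated[OF wH] by (simp add: is_spelling_Cls H.is_spelling_Cls)
  qed
qed

lemma item_length_free_factor:
  assumes "Y \<subseteq> X" "r \<in> nontrivial_items G"
    and "item_in (carrier (subgroup_generated G Y)) r \<in> nontrivial_items (subgroup_generated G Y)"
  shows "item_length (subgroup_generated G Y) Y (item_in (carrier (subgroup_generated G Y)) r)
    = item_length G X r"
proof -
  let ?H = "subgroup_generated G Y"
  interpret H: group ?H by simp
  interpret H: free_basis ?H Y by unfold_locales (rule basis_subgroup_generated[OF assms(1)])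
  show ?thesis
    using is_spelling_free_factor[OF assms H.is_spelling_spelling[OF assms(3)]] item_length_eq assms(2)
    by (simp add: item_length_def[of ?H])
qed

text \<open>A class of \<open>G\<close> that is spelled in \<open>Y\<close> meets the free factor \<open>H\<close> in a single class of \<open>H\<close>:
  two elements of the intersection have cyclically reduced \<open>Y\<close>-spellings up to conjugation
  in \<open>H\<close>, these are rotations of each other, and rotating a word conjugates by an element
  of \<open>H\<close>.\<close>

lemma item_in_free_factor:
  assumes Y: "Y \<subseteq> X" and r: "r \<in> nontrivial_items G" and sup: "support G X r \<subseteq> Y"
  shows "item_in (carrier (subgroup_generated G Y)) r \<in> nontrivial_items (subgroup_generated G Y)"
proof -
  let ?H = "subgroup_generated G Y" and ?w = "spelling G X r"
  interpret H: group ?H by simp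
  interpret H: free_basis ?H Y by unfold_locales (rule basis_subgroup_generated[OF Y])
  have pmY: "pm ?H Y = pm G Y" using H.basis_subset by (rule pm_subgroup_generated)
  note sp = is_spelling_spelling[OF r]
  have "set ?w \<subseteq> pm ?H Y"
    using support_subset_iff[OF Y spelling_letters[OF r]] sup pmY by simp
  then have wH: "list_prod G ?w \<in> carrier ?H"
    using H.list_prod_closed[OF H.word_closed] by simp
  from r show ?thesis
  proof (cases rule: nontrivial_itemE)
    case (Elt g)
    then show ?thesis using wH sp by (auto simp: is_spelling_def nontrivial_items_def)
  next
    case (Cls g)
    let ?h = "list_prod G ?w"
    have h: "?h \<in> conj_class G g" using sp Cls by (simp add: is_spelling_def)
    have Ch: "conj_class G ?h = conj_class G g" using conj_class_eq[OF Cls(2) h] .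
    have "conj_class G g \<inter> carrier ?H \<subseteq> conj_class ?H ?h"
    proof
      fix k assume k: "k \<in> conj_class G g \<inter> carrier ?H"
      have k1: "k \<noteq> \<one>" using k Cls by blast
      then have kn: "Cls (conj_class ?H k) \<in> nontrivial_items ?H"
        using k by (auto simp: nontrivial_items_def)
      then obtain u where u: "is_spelling ?H Y (Cls (conj_class ?H k)) u"
        using H.exists_spelling by blast
      have "\<one>\<^bsub>?H\<^esub> \<notin> conj_class ?H k" using H.one_in_conj_class[of k] k k1 by auto
      then have u': "set u \<subseteq> pm ?H Y" "list_prod G u \<in> conj_class ?H k" "cyc_reduced ?H u"
        using u H.is_spelling_Cls by auto
      have uH: "set u \<subseteq> carrier ?H" using H.word_closed u' by blast
      have "conj_class ?H k \<subseteq> conj_class G g"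
        using conj_class_subgroup_generated[of k Y] k conj_class_eq[of g k] Cls by auto
      then have "is_spelling G X r u"
        using u' Cls pmY pm_mono[OF Y] cyc_reduced_subgroup_generated[OF uH]
        by (auto simp: is_spelling_Cls)
      then obtain n where "?w = rotate n u" using spelling_unique_rotate[OF r _ sp] by blast
      then obtain m where m: "?h = inv\<^bsub>?H\<^esub> (list_prod ?H (take m u)) \<otimes>\<^bsub>?H\<^esub> list_prod ?H u
          \<otimes>\<^bsub>?H\<^esub> list_prod ?H (take m u)"
        using H.list_prod_rotate[OF uH, of n] by auto
      let ?p = "list_prod ?H (take m u)"
      have "set (take m u) \<subseteq> carrier ?H" using uH set_take_subset by (rule order_trans[rotated])
      then have p: "?p \<in> carrier ?H" by (rule H.list_prod_closed)
      have kH: "k \<in> carrier ?H" using k by blast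
      have "inv\<^bsub>?H\<^esub> ?p \<otimes>\<^bsub>?H\<^esub> list_prod ?H u \<otimes>\<^bsub>?H\<^esub> inv\<^bsub>?H\<^esub> (inv\<^bsub>?H\<^esub> ?p) \<in> conj_class ?H k"
        by (rule H.conj_class_conj[OF kH _ H.inv_closed[OF p]]) (use u' in simp)
      then have "?h \<in> conj_class ?H k" unfolding H.inv_inv[OF p] m .
      then show "k \<in> conj_class ?H ?h" by (rule H.conj_class_sym[OF kH])
    qed
    then have "conj_class G g \<inter> carrier ?H = conj_class ?H ?h"
      using conj_class_subgroup_generated[OF wH] Ch by blast
    moreover have "?h \<noteq> \<one>" using h Cls(4) by metis
    ultimately show ?thesis using wH Cls by (auto simp: nontrivial_items_def)
  qed
qed

lemma support_free_factor:
  assumes Y: "Y \<subseteq> X" and r: "r \<in> nontrivial_items G" and sup: "support G X r \<subseteq> Y"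
  shows "support (subgroup_generated G Y) Y (item_in (carrier (subgroup_generated G Y)) r)
    = support G X r"
proof -
  let ?H = "subgroup_generated G Y" and ?r = "item_in (carrier (subgroup_generated G Y)) r"
  interpret H: group ?H by simp
  interpret H: free_basis ?H Y by unfold_locales (rule basis_subgroup_generated[OF Y])
  have r': "?r \<in> nontrivial_items ?H" using assms by (rule item_in_free_factor)
  have "set (spelling ?H Y ?r) = set (spelling G X r)"
    using set_spelling_eq[OF r is_spelling_free_factor[OF Y r r' H.is_spelling_spelling[OF r']]] by simp
  moreover have "set (spelling ?H Y ?r) \<subseteq> carrier ?H"
    using H.word_closed[OF H.spelling_letters[OF r']] .
  ultimately have "pm ?H (set (spelling ?H Y ?r)) = pm G (set (spelling G X r))"
    using pm_subgroup_generated by simp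
  then show ?thesis using sup Y by (auto simp: support_def)
qed

text \<open>A class of \<open>G\<close> is determined by any one of its elements, so restriction to the free factor
  merges no items and a total length over the restricted items is a sum over the original ones.\<close>

lemma inj_on_item_in:
  "inj_on (item_in (carrier (subgroup_generated G Y)))
    {r \<in> nontrivial_items G.
      item_in (carrier (subgroup_generated G Y)) r \<in> nontrivial_items (subgroup_generated G Y)}"
proof (rule inj_onI)
  let ?H = "subgroup_generated G Y"
  interpret H: group ?H by simp
  fix r s
  assume r: "r \<in> {r \<in> nontrivial_items G. item_in (carrier ?H) r \<in> nontrivial_items ?H}"
    and s: "s \<in> {r \<in> nontrivial_items G. item_in (carrier ?H) r \<in> nontrivial_items ?H}"
    and eq: "item_in (carrier ?H) r = item_in (carrier ?H) s"
  show "r = s"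
  proof (cases r)
    case (Elt g)
    then show ?thesis using eq by (cases s) auto
  next
    case (Cls C)
    obtain g where g: "C = conj_class G g" "g \<in> carrier G"
      using r Cls by (auto simp: nontrivial_items_def)
    obtain D where D: "s = Cls D" "C \<inter> carrier ?H = D \<inter> carrier ?H"
      using eq Cls by (cases s) auto
    obtain g' where g': "D = conj_class G g'" "g' \<in> carrier G"
      using s D by (auto simp: nontrivial_items_def)
    obtain h where "h \<in> carrier ?H" "C \<inter> carrier ?H = conj_class ?H h"
      using r Cls by (auto simp: nontrivial_items_def)
    then have "h \<in> C" "h \<in> D" using H.conj_class_self[of h] D(2) by blast+
    then show ?thesis using conj_class_eq g g' Cls D(1) by metis
  qed
qed

section \<open>One step of the algorithm\<close>

lemma restrict_items_nontrivial:
  assumes "R \<subseteq> nontrivial_items G" "Y \<subseteq> X"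
  shows "restrict_items G X R Y \<subseteq> nontrivial_items (subgroup_generated G Y)"
  using item_in_free_factor[OF assms(2)] assms(1) by (auto simp: restrict_items_def)

lemma finest_partition_admissible:
  "R \<subseteq> nontrivial_items G \<Longrightarrow> admissible_partition G X R (finest_partition G X R)"
  using finest_partition_props(1)[of R G X] support_nonempty by (meson subsetD)

lemma block_subset:
  "R \<subseteq> nontrivial_items G \<Longrightarrow> Y \<in> finest_partition G X R \<Longrightarrow> Y \<subseteq> X"
  using finest_partition_admissible[of R] unfolding admissible_partition_def partition_on_def by blast

text \<open>A finer partition of the block \<open>Y\<close> could be spliced into the finest partition of \<open>X\<close>.\<close>

lemma finest_partition_block:
  assumes R: "R \<subseteq> nontrivial_items G" and Y: "Y \<in> finest_partition G X R"
  shows "finest_partition (subgroup_generated G Y) Y (restrict_items G X R Y) = {Y}"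
proof -
  let ?H = "subgroup_generated G Y" and ?S = "restrict_items G X R Y"
  let ?P = "finest_partition G X R" and ?Q = "finest_partition ?H Y ?S"
  have YX: "Y \<subseteq> X" using block_subset[OF R Y] .
  interpret H: group ?H by simp
  interpret H: free_basis ?H Y by unfold_locales (rule basis_subgroup_generated[OF YX])
  have adm: "admissible_partition G X R ?P" using finest_partition_admissible[OF R] .
  have admQ: "admissible_partition ?H Y ?S ?Q"
    using H.finest_partition_admissible[OF restrict_items_nontrivial[OF R YX]] .
  have P: "\<Union> ?P = X" "disjoint ?P" "{} \<notin> ?P"
    using adm by (auto simp: admissible_partition_def partition_on_def)
  have Q: "\<Union> ?Q = Y" "disjoint ?Q" "{} \<notin> ?Q"
    using admQ by (auto simp: admissible_partition_def partition_on_def)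
  have PY: "B \<inter> Y = {}" if "B \<in> ?P" "B \<noteq> Y" for B
    using that P(2) Y by (auto simp: disjoint_def)
  let ?N = "(?P - {Y}) \<union> ?Q"
  have "partition_on X ?N"
  proof (rule partition_onI)
    show "\<Union> ?N = X" using P(1) Q(1) Y by auto
    show "{} \<notin> ?N" using P(3) Q(3) by blast
    fix A B assume "A \<in> ?N" "B \<in> ?N" "A \<noteq> B"
    moreover have "B \<subseteq> Y" if "B \<in> ?Q" for B using that Q(1) by blast
    moreover have "A \<inter> B = {}" if "A \<in> ?P" "B \<in> ?P" "A \<noteq> B" for A B
      using P(2) that by (auto simp: disjoint_def)
    moreover have "A \<inter> B = {}" if "A \<in> ?Q" "B \<in> ?Q" "A \<noteq> B" for A B
      using Q(2) that by (auto simp: disjoint_def)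
    moreover have "A \<inter> B = {}" if "A \<in> ?P - {Y}" "B \<subseteq> Y" for A B
      using PY[of A] that by blast
    ultimately show "disjnt A B" unfolding disjnt_def by (metis Int_commute DiffD1 Un_iff)
  qed
  moreover have "\<exists>B \<in> ?N. support G X r \<subseteq> B" if r: "r \<in> R" for r
  proof -
    obtain B where B: "B \<in> ?P" "support G X r \<subseteq> B"
      using adm r by (auto simp: admissible_partition_def)
    show ?thesis
    proof (cases "B = Y")
      case True
      then have "item_in (carrier ?H) r \<in> ?S" using r B by (auto simp: restrict_items_def)
      then obtain q where "q \<in> ?Q" "support ?H Y (item_in (carrier ?H) r) \<subseteq> q"
        using admQ by (auto simp: admissible_partition_def)
      then show ?thesis using support_free_factor[OF YX] r R B True by auto
    qed (use B in blast)
  qed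
  ultimately have "admissible_partition G X R ?N" by (simp add: admissible_partition_def)
  then have "refines X ?P ?N"
    using finest_partition_props(2)[of R G X] support_nonempty R by (meson subsetD)
  then have "\<forall>A \<in> ?P. \<exists>B \<in> ?N. A \<subseteq> B" unfolding refines_def by blast
  then obtain B where B: "B \<in> ?N" "Y \<subseteq> B" using Y by blast
  have "Y \<noteq> {}" using Y P(3) by blast
  then have "B \<in> ?Q" using B(1) PY[of B] B(2) Int_absorb1[OF B(2)] by (metis DiffE UnE singletonI)
  moreover from this have "B \<subseteq> Y" using Q(1) by blast
  ultimately have YQ: "Y \<in> ?Q" using B(2) by (metis subset_antisym)
  have "q = Y" if "q \<in> ?Q" for q
  proof (rule ccontr)
    assume "q \<noteq> Y"
    then have "q \<inter> Y = {}" using Q(2) that YQ by (auto simp: disjoint_def)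
    moreover have "q \<subseteq> Y" "q \<noteq> {}" using that Q(1,3) by auto
    ultimately show False by blast
  qed
  then show ?thesis using YQ by blast
qed

lemma block_subroutine_input:
  assumes "finite R" "R \<subseteq> nontrivial_items G" "Y \<in> finest_partition G X R"
    and "block_has_cutvertex G X R Y"
  shows "subroutine_input (subgroup_generated G Y) Y (restrict_items G X R Y)"
  unfolding subroutine_input_def
proof (intro conjI)
  have Y: "Y \<subseteq> X" using block_subset assms by blast
  show "basis (subgroup_generated G Y) Y" using basis_subgroup_generated[OF Y] .
  show "finite (restrict_items G X R Y)" using assms(1) by (simp add: restrict_items_def)
  show "restrict_items G X R Y \<subseteq> nontrivial_items (subgroup_generated G Y)"
    using restrict_items_nontrivial assms Y by blast
  show "finest_partition (subgroup_generated G Y) Y (restrict_items G X R Y) = {Y}"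
    using finest_partition_block assms by blast
  show "has_basis_cutvertex (subgroup_generated G Y) Y (restrict_items G X R Y)"
    using assms(4) by (simp add: block_has_cutvertex_def)
qed simp

lemma block_subroutine_exists:
  assumes "R \<subseteq> nontrivial_items G" "Y \<in> finest_partition G X R" "block_has_cutvertex G X R Y"
  shows "\<exists>Y'. subroutine_output (subgroup_generated G Y) Y (restrict_items G X R Y) Y'"
proof -
  have Y: "Y \<subseteq> X" using block_subset assms by blast
  interpret H: group "subgroup_generated G Y" by simp
  interpret H: free_basis "subgroup_generated G Y" Y
    by unfold_locales (rule basis_subgroup_generated[OF Y])
  show ?thesis
    using H.subroutine_applicable[OF restrict_items_nontrivial[OF assms(1) Y]
        finest_partition_block[OF assms(1,2)]] assms(3) by (simp add: block_has_cutvertex_def)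
qed

text \<open>Extending \<open>\<chi>\<close> by \<open>0\<close> outside \<open>Y\<^sup>\<plusminus>\<^sup>1\<close> makes the Whitehead transformation of \<open>Y\<close> one of \<open>X\<close>
  that fixes \<open>X - Y\<close>. Items supported in \<open>Y\<close> have the same length over \<open>X\<close> and over \<open>Y\<close>, and
  over \<open>X'\<close> and over \<open>Y'\<close>; for all others the old spelling is still a word over \<open>X'\<close>.\<close>

lemma block_subroutine_decreases:
  assumes fin: "finite R" and R: "R \<subseteq> nontrivial_items G" and Y: "Y \<in> finest_partition G X R"
    and out: "subroutine_output (subgroup_generated G Y) Y (restrict_items G X R Y) Y'"
  shows "whitehead_neighbour (subgroup_generated G Y) Y Y'"
    and "total_length (subgroup_generated G Y) Y' (restrict_items G X R Y)
      < total_length (subgroup_generated G Y) Y (restrict_items G X R Y)"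
    and "whitehead_neighbour G X ((X - Y) \<union> Y')"
    and "total_length G ((X - Y) \<union> Y') R < total_length G X R"
proof -
  let ?H = "subgroup_generated G Y" and ?S = "restrict_items G X R Y"
  let ?X = "(X - Y) \<union> Y'"
  have YX: "Y \<subseteq> X" using block_subset[OF R Y] .
  interpret H: group ?H by simp
  interpret H: free_basis ?H Y by unfold_locales (rule basis_subgroup_generated[OF YX])
  have pmY: "pm ?H Y = pm G Y" using H.basis_subset by (rule pm_subgroup_generated)
  have Sn: "?S \<subseteq> nontrivial_items ?H" using restrict_items_nontrivial[OF R YX] .
  have Sf: "finite ?S" using fin by (simp add: restrict_items_def)
  obtain y \<chi> l where Y': "Y' = whitehead_map ?H y \<chi> ` Y" and y: "y \<in> pm ?H Y"
    and \<chi>i: "\<chi> (inv\<^bsub>?H\<^esub> y) = \<chi> y" and l: "l = 0 \<or> l = - 1"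
    and \<chi>: "\<forall>a \<in> pm ?H Y. \<chi> a = l \<or> \<chi> a = l + 1"
    and less: "total_length ?H Y' ?S < total_length ?H Y ?S"
    by (rule H.subroutine_output_decreases[OF Sf Sn out])
  show nbH: "whitehead_neighbour ?H Y Y'"
    unfolding Y' using y \<chi>i l by (rule H.whitehead_neighbour_map) (use \<chi> in blast)
  show "total_length ?H Y' ?S < total_length ?H Y ?S" by fact
  have yH: "y \<in> carrier ?H" using H.letter_closed[OF y] .
  define \<chi>' where "\<chi>' a = (if a \<in> pm G Y then \<chi> a else 0)" for a
  have yX: "y \<in> pm G X" using y pmY pm_mono[OF YX] by blast
  have iy: "inv y \<in> pm G Y" using H.inv_letter[OF y] pmY yH by simp
  have \<chi>'y: "\<chi>' (inv y) = \<chi>' y" using \<chi>i y iy pmY yH by (simp add: \<chi>'_def)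
  have "whitehead_map ?H y \<chi> x = whitehead_map G y \<chi>' x" if "x \<in> Y" for x
  proof -
    have "x \<in> carrier ?H" using that H.basis_subset by blast
    then show ?thesis
      using that yH whitehead_map_subgroup_generated[of y Y x \<chi>]
      by (simp add: whitehead_map_def \<chi>'_def pm_def)
  qed
  moreover have "whitehead_map G y \<chi>' x = x" if "x \<in> X - Y" for x
  proof -
    have xc: "x \<in> carrier G" using that basis_subset by blast
    have "inv x \<notin> Y" using that inv_not_in_basis[of x] YX by blast
    moreover have "x \<noteq> inv z" if "z \<in> Y" for z
      using that inv_not_in_basis[of z] YX \<open>x \<in> X - Y\<close> by blast
    moreover have "inv x \<noteq> inv z" if "z \<in> Y" for z
      using that \<open>x \<in> X - Y\<close> xc YX basis_subset by (metis DiffD2 inv_inv subsetD)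
    ultimately have "\<chi>' x = 0" "\<chi>' (inv x) = 0" using that by (auto simp: \<chi>'_def pm_def)
    then show ?thesis using xc by (simp add: whitehead_map_def)
  qed
  ultimately have X': "?X = whitehead_map G y \<chi>' ` X"
    unfolding Y' using YX by (auto simp: image_iff) metis+
  show nb: "whitehead_neighbour G X ?X"
    unfolding X' using yX \<chi>'y l by (rule whitehead_neighbour_map) (use \<chi> pmY l in \<open>auto simp: \<chi>'_def\<close>)
  have "basis G ?X" using nb by (simp add: whitehead_neighbour_def)
  then interpret X': free_basis G ?X by unfold_locales
  have bY': "basis ?H Y'" using nbH by (simp add: whitehead_neighbour_def)
  have HY': "subgroup_generated G Y' = ?H"
  proof -
    have "Y' \<subseteq> carrier ?H" using bY' by (simp add: basis_def)
    then have "generate G Y' = carrier ?H"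
      using bY' generate_subgroup_generated[of Y' Y] by (simp add: basis_def)
    moreover have "carrier G \<inter> Y' = Y'" using X'.basis_subset by blast
    ultimately show ?thesis
      using carrier_subgroup_generated[of G Y] by (simp add: subgroup_generated_def)
  qed
  define R1 where "R1 = {r \<in> R. support G X r \<subseteq> Y}"
  have S: "?S = item_in (carrier ?H) ` R1" by (simp add: restrict_items_def R1_def)
  have R1: "R1 \<subseteq> {r \<in> nontrivial_items G. item_in (carrier ?H) r \<in> nontrivial_items ?H}"
    using Sn R unfolding S R1_def by blast
  have inj: "inj_on (item_in (carrier ?H)) R1" using inj_on_item_in R1 by (rule inj_on_subset)
  have "(\<Sum>r\<in>R1. item_length G ?X r) = total_length ?H Y' ?S"
    using R1 X'.item_length_free_factor[of Y'] unfolding total_length_def S sum.reindex[OF inj]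
    by (intro sum.cong) (auto simp: HY')
  moreover have "(\<Sum>r\<in>R1. item_length G X r) = total_length ?H Y ?S"
    using R1 item_length_free_factor[OF YX] unfolding total_length_def S sum.reindex[OF inj]
    by (intro sum.cong) auto
  ultimately have less1: "(\<Sum>r\<in>R1. item_length G ?X r) < (\<Sum>r\<in>R1. item_length G X r)"
    using less by simp
  have "item_length G ?X r \<le> item_length G X r" if r: "r \<in> R - R1" for r
  proof -
    have rn: "r \<in> nontrivial_items G" using r R by blast
    have adm: "admissible_partition G X R (finest_partition G X R)"
      using finest_partition_admissible[OF R] .
    then obtain B where B: "B \<in> finest_partition G X R" "support G X r \<subseteq> B"
      using r by (auto simp: admissible_partition_def)
    have "B \<noteq> Y" using r B by (auto simp: R1_def)
    then have "B \<inter> Y = {}"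
      using adm B Y by (auto simp: admissible_partition_def partition_on_def disjoint_def)
    then have "B \<subseteq> X - Y" using block_subset[OF R B(1)] by blast
    moreover have "set (spelling G X r) \<subseteq> pm G B"
      using support_subset_iff[OF block_subset[OF R B(1)] spelling_letters[OF rn]] B(2) by simp
    ultimately have "set (spelling G X r) \<subseteq> pm G ?X" using pm_mono[of B ?X] by blast
    then show ?thesis
      using X'.item_length_le[OF rn] is_spelling_spelling[OF rn]
      by (simp add: item_length_def is_spelling_def)
  qed
  then have le2: "(\<Sum>r\<in>R - R1. item_length G ?X r) \<le> (\<Sum>r\<in>R - R1. item_length G X r)"
    by (rule sum_mono)
  have "R1 \<subseteq> R" by (auto simp: R1_def)
  then have "total_length G Z R = (\<Sum>r\<in>R - R1. item_length G Z r) + (\<Sum>r\<in>R1. item_length G Z r)" for Z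
    unfolding total_length_def using fin by (rule sum.subset_diff)
  then show "total_length G ?X R < total_length G X R" using less1 le2 by simp
qed

end

section \<open>The algorithm\<close>

lemma algorithm_step_basis:
  assumes "group F" "finite R" "R \<subseteq> nontrivial_items F" "basis F Z" "algorithm_step F R Z Z'"
  shows "basis F Z'" "total_length F Z' R < total_length F Z R"
proof -
  interpret group F by fact
  interpret free_basis F Z by unfold_locales fact
  obtain Y Y' where "Y \<in> finest_partition F Z R"
    "subroutine_output (subgroup_generated F Y) Y (restrict_items F Z R Y) Y'" "Z' = (Z - Y) \<union> Y'"
    using assms(5) by (auto simp: algorithm_step_def)
  then show "basis F Z'" "total_length F Z' R < total_length F Z R"
    using block_subroutine_decreases[OF assms(2,3)] by (auto simp: whitehead_neighbour_def)
qed

lemma algorithm_reaches_basis: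
  assumes "group F" "finite R" "R \<subseteq> nontrivial_items F" "basis F X" "algorithm_reaches F R X Z"
  shows "basis F Z"
  using assms(5,4) unfolding algorithm_reaches_def
  by (induction rule: rtranclp_induct) (use algorithm_step_basis(1)[OF assms(1-3)] in auto)

theorem mainTheorem4:
  fixes F :: "('a, 'b) monoid_scheme" and X :: "'a set" and R :: "'a item set"
  assumes "finite_rank_free_group F"
    and "basis F X"
    and "finite R"
    and "R \<subseteq> nontrivial_items F"
  shows "(\<forall>Z. algorithm_reaches F R X Z \<longrightarrow>
            basis F Z \<and>
            (\<forall>Y \<in> finest_partition F Z R. block_has_cutvertex F Z R Y \<longrightarrow>
               (let H = subgroup_generated F Y; S = restrict_items F Z R Y in
                  subroutine_input H Y S \<and>
                  (\<exists>Y'. subroutine_output H Y S Y') \<and>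
                  (\<forall>Y'. subroutine_output H Y S Y' \<longrightarrow>
                     whitehead_neighbour H Y Y' \<and>
                     total_length H Y' S < total_length H Y S \<and>
                     whitehead_neighbour F Z ((Z - Y) \<union> Y') \<and>
                     total_length F ((Z - Y) \<union> Y') R < total_length F Z R))))
       \<and> \<not> (\<exists>f :: nat \<Rightarrow> 'a set. f 0 = X \<and> (\<forall>n. algorithm_step F R (f n) (f (Suc n))))
       \<and> (\<exists>Z. algorithm_outputs F R X Z)
       \<and> (\<forall>Z. algorithm_outputs F R X Z \<longrightarrow> basis F Z \<and> cutvertex_free F R Z)"
proof -
  interpret group F using assms(1) by (simp add: finite_rank_free_group_def)
  note reach_basis = algorithm_reaches_basis[OF is_group assms(3,4,2)]
  have block: "let H = subgroup_generated F Y; S = restrict_items F Z R Y in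
      subroutine_input H Y S \<and> (\<exists>Y'. subroutine_output H Y S Y') \<and>
      (\<forall>Y'. subroutine_output H Y S Y' \<longrightarrow>
        whitehead_neighbour H Y Y' \<and> total_length H Y' S < total_length H Y S \<and>
        whitehead_neighbour F Z ((Z - Y) \<union> Y') \<and>
        total_length F ((Z - Y) \<union> Y') R < total_length F Z R)"
    if Z: "basis F Z" and Y: "Y \<in> finest_partition F Z R" and cut: "block_has_cutvertex F Z R Y"
    for Z Y
  proof -
    interpret Z: free_basis F Z by unfold_locales (rule Z)
    show ?thesis
      unfolding Let_def
      using Z.block_subroutine_input[OF assms(3,4) Y cut] Z.block_subroutine_exists[OF assms(4) Y cut]
        Z.block_subroutine_decreases[OF assms(3,4) Y] by blast
  qed
  have terminates: "\<nexists>f. f 0 = X \<and> (\<forall>n. algorithm_step F R (f n) (f (Suc n)))"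
  proof
    assume "\<exists>f. f 0 = X \<and> (\<forall>n. algorithm_step F R (f n) (f (Suc n)))"
    then obtain f where f: "f 0 = X" "\<And>n. algorithm_step F R (f n) (f (Suc n))" by blast
    have basis_f: "basis F (f n)" for n
      by (induction n) (use f assms(2) algorithm_step_basis(1)[OF is_group assms(3,4)] in auto)
    have "(f (Suc n), f n) \<in> measure (\<lambda>Z. total_length F Z R)" for n
      using algorithm_step_basis(2)[OF is_group assms(3,4) basis_f f(2)] by simp
    then show False using wf_measure wf_no_infinite_down_chainE by metis
  qed
  have reaches_output: "\<exists>W. algorithm_outputs F R Z W" if "basis F Z" for Z
    using that
  proof (induction "total_length F Z R" arbitrary: Z rule: less_induct)
    case less
    show ?case
    proof (cases "\<exists>Y \<in> finest_partition F Z R. block_has_cutvertex F Z R Y")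
      case False
      then show ?thesis
        by (intro exI[of _ Z]) (simp add: algorithm_outputs_def algorithm_reaches_def)
    next
      case True
      then obtain Y Y' where "Y \<in> finest_partition F Z R" "block_has_cutvertex F Z R Y"
        "subroutine_output (subgroup_generated F Y) Y (restrict_items F Z R Y) Y'"
        using block[OF less.prems] unfolding Let_def by blast
      then have step: "algorithm_step F R Z ((Z - Y) \<union> Y')" by (auto simp: algorithm_step_def)
      obtain W where "algorithm_outputs F R ((Z - Y) \<union> Y') W"
        using less.hyps algorithm_step_basis[OF is_group assms(3,4) less.prems step] by blast
      then show ?thesis
        using step unfolding algorithm_outputs_def algorithm_reaches_def
        by (meson converse_rtranclp_into_rtranclp)
    qed
  qed
  have "cutvertex_free F R Z" if "algorithm_outputs F R X Z" for Z
    using that by (auto simp: algorithm_outputs_def cutvertex_free_def)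
  then show ?thesis
    using reach_basis block terminates reaches_output[OF assms(2)]
    by (simp add: algorithm_outputs_def)
qed

end
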